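(* Let $i_1=1$, $i_2=a_1e_1+a_2e_2$, $i_3=b_1e_1+b_2e_2$ ($a_k,b_k\in\mathbb{C}$) be linearly independent over $\mathbb{R}$ in $\mathbb{H}(\mathbb{C})$, and assume $f_1(E_3)=f_2(E_3)=\mathbb{C}$. Let $\Omega\subset\mathbb{R}^3$ be a domain that is convex in the direction of the straight lines $L^1$ and $L^2$. Let $\Phi:\Omega_\zeta\to\mathbb{H}(\mathbb{C})$ be a right-$G$-monogenic mapping in $\Omega_\zeta$ and $\widehat\Phi:\Omega_\zeta\to\mathbb{H}(\mathbb{C})$ a left-$G$-monogenic mapping in $\Omega_\zeta$. Then for every point $\zeta_0\in\Omega_\zeta$ the following equalities are true: $$\Phi(\zeta_0)=\frac{1}{2\pi i}\int_{\gamma_\zeta}(\zeta-\zeta_0)^{-1}d\zeta\,\Phi(\zeta) \qquad\text{and}\qquad \widehat\Phi(\zeta_0)=\frac{1}{2\pi i}\int_{\gamma_\zeta}\widehat\Phi(\zeta)(\zeta-\zeta_0)^{-1}d\zeta ,$$ where $\gamma_\zeta$ is an arbitrary closed Jordan rectifiable curve in $\Omega_\zeta$ that embraces once the set $M(\zeta_0)=\{\zeta\in E_3:\zeta-\zeta_0\in L^1_\zeta\cup L^2_\zeta\}$.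
   Context: $\mathbb{H}(\mathbb{C})$ is the quaternion algebra over $\mathbb{C}$ with basis $1,I,J,K$ and rules $I^2=J^2=K^2=-1$, $IJ=-JI=K$, $JK=-KJ=I$, $KI=-IK=J$. With $i$ the complex imaginary unit, another basis is $$e_1=\tfrac12(1+iI),\quad e_2=\tfrac12(1-iI),\quad e_3=\tfrac12(iJ-K),\quad e_4=\tfrac12(iJ+K).$$ Its nonzero products are $e_1e_1=e_1$, $e_1e_3=e_3$, $e_2e_2=e_2$, $e_2e_4=e_4$, $e_3e_2=e_3$, $e_3e_4=e_1$, $e_4e_1=e_4$, $e_4e_3=e_2$, all other products $e_je_k$ are $0$, and $1=e_1+e_2$. $f_1,f_2:\mathbb{H}(\mathbb{C})\to\mathbb{C}$ are the linear functionals with $f_1(e_1)=f_1(e_3)=1$, $f_1(e_2)=f_1(e_4)=0$, $f_2(e_2)=f_2(e_4)=1$, $f_2(e_1)=f_2(e_3)=0$. $E_3:=\{\zeta=xi_1+yi_2+zi_3: x,y,z\in\mathbb{R}\}$. For $\zeta\in E_3$ put $\xi_k:=f_k(\zeta)=x+ya_k+zb_k$, $k=1,2$, so $\zeta=\xi_1e_1+\xi_2e_2$; $\zeta$ is invertible iff $\xi_1\ne0$ and $\xi_2\neq0$, and then $\zeta^{-1}=\xi_1^{-1}e_1+\xi_2^{-1}e_2$. For $S\subset\mathbb{R}^3$ put $S_\zeta:=\{xi_1+yi_2+zi_3:(x,y,z)\in S\}\subset E_3$; topological notions (domain, homotopy, etc.) for $S_\zeta$ are those of $S$ in $\mathbb{R}^3$.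 $L^k\subset\mathbb{R}^3$ ($k=1,2$) is the line $x+y\,\mathrm{Re}\,a_k+z\,\mathrm{Re}\,b_k=0$, $y\,\mathrm{Im}\,a_k+z\,\mathrm{Im}\,b_k=0$ (i.e. $\xi_k=0$). A domain $\Omega$ is convex in the direction of a line $L$ if it contains every segment that is parallel to $L$ and has both endpoints in $\Omega$. A continuous mapping $\Phi:\Omega_\zeta\to\mathbb{H}(\mathbb{C})$ is right-$G$-monogenic in $\Omega_\zeta$ if for every $\zeta\in\Omega_\zeta$ there is $\Phi'(\zeta)\in\mathbb{H}(\mathbb{C})$ with $\lim_{\varepsilon\to0+}(\Phi(\zeta+\varepsilon h)-\Phi(\zeta))\varepsilon^{-1}=h\,\Phi'(\zeta)$ for all $h\in E_3$. A continuous mapping $\widehat\Phi$ is left-$G$-monogenic if for every $\zeta\in\Omega_\zeta$ there is $\widehat\Phi'(\zeta)\in\mathbb{H}(\mathbb{C})$ with $\lim_{\varepsilon\to0+}(\widehat\Phi(\zeta+\varepsilon h)-\widehat\Phi(\zeta))\varepsilon^{-1}=\widehat\Phi'(\zeta)\,h$ for all $h\in E_3$. For a Jordan rectifiable curve $\gamma\subset\mathbb{R}^3$ and continuous $\Psi=\sum_{k=1}^4\Psi_ke_k:\gamma_\zeta\to\mathbb{H}(\mathbb{C})$ with complex-valued $\Psi_k$, the line integrals (with $d\zeta=dx+i_2dy+i_3dz$) are $$\int_{\gamma_\zeta}d\zeta\,\Psi(\zeta):=\sum_{k=1}^4\Big(e_k\int_\gamma\Psi_k\,dx+i_2e_k\int_\gamma\Psi_k\,dy+i_3e_k\int_\gamma\Psi_k\,dz\Big),$$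 $$\int_{\gamma_\zeta}\Psi(\zeta)\,d\zeta:=\sum_{k=1}^4\Big(e_k\int_\gamma\Psi_k\,dx+e_ki_2\int_\gamma\Psi_k\,dy+e_ki_3\int_\gamma\Psi_k\,dz\Big).$$ Since $(\zeta-\zeta_0)^{-1}$ and $d\zeta$ take values in the commutative span of $e_1,e_2$, $\int_{\gamma_\zeta}(\zeta-\zeta_0)^{-1}d\zeta\,\Phi(\zeta)$ means $\int_{\gamma_\zeta}d\zeta\,\Psi(\zeta)$ with $\Psi(\zeta)=(\zeta-\zeta_0)^{-1}\Phi(\zeta)$. Embracing: let $\zeta_0=\xi_1^{(0)}e_1+\xi_2^{(0)}e_2\in\Omega_\zeta$. Let $C(\zeta_0)$ be a circle centered at $\zeta_0$ taken in a neighborhood of $\zeta_0$ contained in $\Omega_\zeta$, and let $C_k\subset\mathbb{C}$ be its image under $f_k$, $k=1,2$. The circle $C(\zeta_0)$ embraces the set $M(\zeta_0)$ if, for $k=1,2$, $C_k$ bounds some domain $D_k'\subset\mathbb{C}$ and $\xi_k^{(0)}\in D_k'$. A curve $\gamma_\zeta\subset\Omega_\zeta$ embraces once the set $M(\zeta_0)$ if there is a circle $C(\zeta_0)$ which embraces $M(\zeta_0)$ and is homotopic to $\gamma_\zeta$ in the domain $\Omega_\zeta\setminus M(\zeta_0)$.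
   Formalization: The circle C(ζ0) homotopic to γ_ζ is taken in a closed ball contained in Ω_ζ and oriented so that both images C_1 and C_2 wind once counterclockwise around ξ_1^(0) and ξ_2^(0); without this orientation condition the formula can fail. *)

theory Defs
  imports "HOL-Complex_Analysis.Complex_Analysis"
begin

codatatype cquat = CQuat (q1: complex) (qI: complex) (qJ: complex) (qK: complex)

lemma cquat_eq_iff: "p = q \<longleftrightarrow> q1 p = q1 q \<and> qI p = qI q \<and> qJ p = qJ q \<and> qK p = qK q"
  using cquat.expand by blast

instantiation cquat :: ring_1
begin

definition "0 = CQuat 0 0 0 0"
definition "1 = CQuat 1 0 0 0"
definition "p + q = CQuat (q1 p + q1 q) (qI p + qI q) (qJ p + qJ q) (qK p + qK q)"
definition "- p = CQuat (- q1 p) (- qI p) (- qJ p) (- qK p)"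
definition "p - q = CQuat (q1 p - q1 q) (qI p - qI q) (qJ p - qJ q) (qK p - qK q)"
definition "p * q = CQuat
  (q1 p * q1 q - qI p * qI q - qJ p * qJ q - qK p * qK q)
  (q1 p * qI q + qI p * q1 q + qJ p * qK q - qK p * qJ q)
  (q1 p * qJ q - qI p * qK q + qJ p * q1 q + qK p * qI q)
  (q1 p * qK q + qI p * qJ q - qJ p * qI q + qK p * q1 q)"

instance
  by standard
     (simp_all add: zero_cquat_def one_cquat_def plus_cquat_def uminus_cquat_def
        minus_cquat_def times_cquat_def algebra_simps)

end

instantiation cquat :: real_algebra_1
begin

definition "r *\<^sub>R q = CQuat (r *\<^sub>R q1 q) (r *\<^sub>R qI q) (r *\<^sub>R qJ q) (r *\<^sub>R qK q)"

instance
  by standard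
     (simp_all add: plus_cquat_def times_cquat_def scaleR_cquat_def algebra_simps)

end

text \<open>The Euclidean norm of the eight real coordinates; it only serves to fix the topology
  (it is not submultiplicative).\<close>

instantiation cquat :: real_normed_vector
begin

definition "norm q = norm (q1 q, qI q, qJ q, qK q)"
definition "sgn q = q /\<^sub>R norm (q :: cquat)"
definition "dist p q = norm (p - q :: cquat)"
definition [code del]:
  "(uniformity :: (cquat \<times> cquat) filter) = (INF e\<in>{0 <..}. principal {(x, y). dist x y < e})"
definition [code del]:
  "open (U :: cquat set) \<longleftrightarrow> (\<forall>x\<in>U. eventually (\<lambda>(x', y). x' = x \<longrightarrow> y \<in> U) uniformity)"

instance
proof
  fix r :: real and p q :: cquat and U :: "cquat set"
  show "(norm q = 0) = (q = 0)"
    by (simp add: norm_cquat_def zero_cquat_def cquat_eq_iff zero_prod_def)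
  show "norm (p + q) \<le> norm p + norm q"
    using norm_triangle_ineq[of "(q1 p, qI p, qJ p, qK p)" "(q1 q, qI q, qJ q, qK q)"]
    by (simp add: norm_cquat_def plus_cquat_def)
  show "norm (r *\<^sub>R q) = \<bar>r\<bar> * norm q"
    using norm_scaleR[of r "(q1 q, qI q, qJ q, qK q)"]
    by (simp only: norm_cquat_def scaleR_cquat_def cquat.sel scaleR_Pair)
qed (rule sgn_cquat_def dist_cquat_def uniformity_cquat_def open_cquat_def)+

end

definition of_complex :: "complex \<Rightarrow> cquat" where
  "of_complex c = CQuat c 0 0 0"

definition unit_I :: cquat where "unit_I = CQuat 0 1 0 0"
definition unit_J :: cquat where "unit_J = CQuat 0 0 1 0"
definition unit_K :: cquat where "unit_K = CQuat 0 0 0 1"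

lemmas cquat_defs =
  zero_cquat_def one_cquat_def plus_cquat_def uminus_cquat_def minus_cquat_def times_cquat_def
  of_complex_def unit_I_def unit_J_def unit_K_def

lemma unit_rules:
  "unit_I * unit_I = -1" "unit_J * unit_J = -1" "unit_K * unit_K = -1"
  "unit_I * unit_J = unit_K" "unit_J * unit_I = - unit_K"
  "unit_J * unit_K = unit_I" "unit_K * unit_J = - unit_I"
  "unit_K * unit_I = unit_J" "unit_I * unit_K = - unit_J"
  by (simp_all add: cquat_defs)

lemma of_complex_commute: "of_complex c * q = q * of_complex c"
  by (simp add: cquat_defs)

lemma cquat_expansion:
  "q = of_complex (q1 q) + of_complex (qI q) * unit_I
     + of_complex (qJ q) * unit_J + of_complex (qK q) * unit_K"
  by (simp add: cquat_defs)

definition e1 :: cquat where "e1 = of_complex (1/2) * (1 + of_complex \<i> * unit_I)"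
definition e2 :: cquat where "e2 = of_complex (1/2) * (1 - of_complex \<i> * unit_I)"
definition e3 :: cquat where "e3 = of_complex (1/2) * (of_complex \<i> * unit_J - unit_K)"
definition e4 :: cquat where "e4 = of_complex (1/2) * (of_complex \<i> * unit_J + unit_K)"

lemmas e_defs = e1_def e2_def e3_def e4_def

lemma e_products:
  "e1 * e1 = e1" "e1 * e2 = 0" "e1 * e3 = e3" "e1 * e4 = 0"
  "e2 * e1 = 0" "e2 * e2 = e2" "e2 * e3 = 0" "e2 * e4 = e4"
  "e3 * e1 = 0" "e3 * e2 = e3" "e3 * e3 = 0" "e3 * e4 = e1"
  "e4 * e1 = e4" "e4 * e2 = 0" "e4 * e3 = e2" "e4 * e4 = 0"
  by (simp_all add: e_defs cquat_defs)

text \<open>Coordinates with respect to the basis \<open>e1, e2, e3, e4\<close>; see \<open>coord_unique\<close>.\<close>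

definition coord1 :: "cquat \<Rightarrow> complex" where "coord1 q = q1 q - \<i> * qI q"
definition coord2 :: "cquat \<Rightarrow> complex" where "coord2 q = q1 q + \<i> * qI q"
definition coord3 :: "cquat \<Rightarrow> complex" where "coord3 q = - \<i> * qJ q - qK q"
definition coord4 :: "cquat \<Rightarrow> complex" where "coord4 q = - \<i> * qJ q + qK q"

lemmas coord_defs = coord1_def coord2_def coord3_def coord4_def

lemma coord_unique:
  "q = of_complex c1 * e1 + of_complex c2 * e2 + of_complex c3 * e3 + of_complex c4 * e4 \<longleftrightarrow>
   c1 = coord1 q \<and> c2 = coord2 q \<and> c3 = coord3 q \<and> c4 = coord4 q"
proof -
  have lin: "q1 q = (c1 + c2) / 2 \<and> qI q = \<i> * (c1 - c2) / 2 \<longleftrightarrow>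
      c1 = q1 q - \<i> * qI q \<and> c2 = q1 q + \<i> * qI q"
    by (auto simp: complex_eq_iff field_simps)
  have lin': "qJ q = \<i> * (c3 + c4) / 2 \<and> qK q = (c4 - c3) / 2 \<longleftrightarrow>
      c3 = - \<i> * qJ q - qK q \<and> c4 = - \<i> * qJ q + qK q"
    by (auto simp: complex_eq_iff field_simps)
  have "of_complex c1 * e1 + of_complex c2 * e2 + of_complex c3 * e3 + of_complex c4 * e4 =
      CQuat ((c1 + c2) / 2) (\<i> * (c1 - c2) / 2) (\<i> * (c3 + c4) / 2) ((c4 - c3) / 2)"
    by (simp add: e_defs cquat_defs field_simps)
  then have "q = of_complex c1 * e1 + of_complex c2 * e2 + of_complex c3 * e3 + of_complex c4 * e4 \<longleftrightarrow>
      (q1 q = (c1 + c2) / 2 \<and> qI q = \<i> * (c1 - c2) / 2) \<and>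
      (qJ q = \<i> * (c3 + c4) / 2 \<and> qK q = (c4 - c3) / 2)"
    by (simp only: cquat_eq_iff cquat.sel conj_assoc)
  then show ?thesis
    unfolding lin lin' by (simp only: coord_defs conj_assoc)
qed

definition f1 :: "cquat \<Rightarrow> complex" where "f1 q = coord1 q + coord3 q"
definition f2 :: "cquat \<Rightarrow> complex" where "f2 q = coord2 q + coord4 q"

lemma f_linear:
  "f1 (p + q) = f1 p + f1 q" "f1 (of_complex c * q) = c * f1 q"
  "f2 (p + q) = f2 p + f2 q" "f2 (of_complex c * q) = c * f2 q"
  by (simp_all add: f1_def f2_def coord_defs cquat_defs algebra_simps)

lemma f_basis:
  "f1 e1 = 1" "f1 e2 = 0" "f1 e3 = 1" "f1 e4 = 0"
  "f2 e1 = 0" "f2 e2 = 1" "f2 e3 = 0" "f2 e4 = 1"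
  by (simp_all add: f1_def f2_def coord_defs e_defs cquat_defs)

definition qinv :: "cquat \<Rightarrow> cquat" where
  "qinv q = (THE p. p * q = 1 \<and> q * p = 1)"

lemma qinv_eqI:
  assumes "p * q = 1" "q * p = 1"
  shows "qinv q = p"
  unfolding qinv_def
proof (rule the_equality)
  show "p * q = 1 \<and> q * p = 1" using assms by simp
  fix r assume "r * q = 1 \<and> q * r = 1"
  then show "r = p" using assms by (metis mult.assoc mult.left_neutral mult.right_neutral)
qed

definition zeta :: "cquat \<Rightarrow> cquat \<Rightarrow> real^3 \<Rightarrow> cquat" where
  "zeta i2 i3 p = p$1 *\<^sub>R 1 + p$2 *\<^sub>R i2 + p$3 *\<^sub>R i3"

definition E3 :: "cquat \<Rightarrow> cquat \<Rightarrow> cquat set" where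
  "E3 i2 i3 = range (zeta i2 i3)"

text \<open>\<open>kernel_line a b\<close> is the line $L^k$ when \<open>a\<close> and \<open>b\<close> are the coefficients
  $a_k$, $b_k$ of \<open>i2\<close>, \<open>i3\<close>, i.e. \<open>a = f\<^sub>k i2\<close> and \<open>b = f\<^sub>k i3\<close>.\<close>

definition kernel_line :: "complex \<Rightarrow> complex \<Rightarrow> (real^3) set" where
  "kernel_line a b =
    {p. p$1 + p$2 * Re a + p$3 * Re b = 0 \<and> p$2 * Im a + p$3 * Im b = 0}"

text \<open>\<open>L\<close> is meant to be a line through the origin, so that a segment is parallel to \<open>L\<close>
  iff the difference of its endpoints lies in \<open>L\<close>.\<close>

definition convex_in_direction :: "(real^3) set \<Rightarrow> (real^3) set \<Rightarrow> bool" where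
  "convex_in_direction L \<Omega> \<longleftrightarrow>
    (\<forall>p\<in>\<Omega>. \<forall>q\<in>\<Omega>. q - p \<in> L \<longrightarrow> closed_segment p q \<subseteq> \<Omega>)"

definition M_set :: "cquat \<Rightarrow> cquat \<Rightarrow> cquat \<Rightarrow> cquat set" where
  "M_set i2 i3 \<zeta>0 =
    {\<zeta> \<in> E3 i2 i3. \<zeta> - \<zeta>0 \<in> zeta i2 i3 ` kernel_line (f1 i2) (f1 i3)
                            \<union> zeta i2 i3 ` kernel_line (f2 i2) (f2 i3)}"

text \<open>The parameter \<open>S\<close> is the domain \<open>\<Omega>\<^sub>\<zeta>\<close>, relatively open in \<open>E3\<close>: values outside \<open>S\<close>
  do not influence the limits.\<close>

definition right_G_monogenic :: "cquat \<Rightarrow> cquat \<Rightarrow> cquat set \<Rightarrow> (cquat \<Rightarrow> cquat) \<Rightarrow> bool" where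
  "right_G_monogenic i2 i3 S \<Phi> \<longleftrightarrow>
    continuous_on S \<Phi> \<and>
    (\<forall>\<zeta>\<in>S. \<exists>\<Phi>'. \<forall>h\<in>E3 i2 i3.
      ((\<lambda>\<epsilon>::real. (\<Phi> (\<zeta> + \<epsilon> *\<^sub>R h) - \<Phi> \<zeta>) /\<^sub>R \<epsilon>) \<longlongrightarrow> h * \<Phi>') (at_right 0))"

definition left_G_monogenic :: "cquat \<Rightarrow> cquat \<Rightarrow> cquat set \<Rightarrow> (cquat \<Rightarrow> cquat) \<Rightarrow> bool" where
  "left_G_monogenic i2 i3 S \<Phi> \<longleftrightarrow>
    continuous_on S \<Phi> \<and>
    (\<forall>\<zeta>\<in>S. \<exists>\<Phi>'. \<forall>h\<in>E3 i2 i3.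
      ((\<lambda>\<epsilon>::real. (\<Phi> (\<zeta> + \<epsilon> *\<^sub>R h) - \<Phi> \<zeta>) /\<^sub>R \<epsilon>) \<longlongrightarrow> \<Phi>' * h) (at_right 0))"

definition rectifiable :: "(real \<Rightarrow> 'a::real_normed_vector) \<Rightarrow> bool" where
  "rectifiable \<gamma> \<longleftrightarrow>
    (\<exists>B. \<forall>d. d division_of {0..1} \<longrightarrow> (\<Sum>K\<in>d. norm (\<gamma> (Sup K) - \<gamma> (Inf K))) \<le> B)"

text \<open>The Riemann--Stieltjes integral of \<open>f\<close> with respect to \<open>g\<close> over \<open>[0,1]\<close>, as the limit of
  the tagged sums when the mesh tends to 0. A line integral \<open>\<integral>\<^sub>\<gamma> \<psi> dx\<close> over a rectifiable curve
  is this integral for \<open>f = \<psi> \<circ> \<gamma>\<close> and \<open>g\<close> the \<open>x\<close>-coordinate of \<open>\<gamma>\<close>.\<close>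

definition has_RS_integral :: "(real \<Rightarrow> complex) \<Rightarrow> (real \<Rightarrow> real) \<Rightarrow> complex \<Rightarrow> bool" where
  "has_RS_integral f g I \<longleftrightarrow>
    (\<forall>\<epsilon>>0. \<exists>\<delta>>0. \<forall>\<D>. \<D> tagged_division_of {0..1} \<and> (\<forall>(t, K)\<in>\<D>. diameter K < \<delta>) \<longrightarrow>
      norm ((\<Sum>(t, K)\<in>\<D>. f t * of_real (g (Sup K) - g (Inf K))) - I) < \<epsilon>)"

definition line_integral :: "3 \<Rightarrow> (real \<Rightarrow> real^3) \<Rightarrow> (real^3 \<Rightarrow> complex) \<Rightarrow> complex" where
  "line_integral j \<gamma> \<psi> = (THE I. has_RS_integral (\<lambda>t. \<psi> (\<gamma> t)) (\<lambda>t. \<gamma> t $ j) I)"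

definition integral_dzeta_left ::
  "cquat \<Rightarrow> cquat \<Rightarrow> (real \<Rightarrow> real^3) \<Rightarrow> (cquat \<Rightarrow> cquat) \<Rightarrow> cquat" where
  "integral_dzeta_left i2 i3 \<gamma> \<Psi> =
    (\<Sum>(e, \<psi>)\<leftarrow>[(e1, coord1), (e2, coord2), (e3, coord3), (e4, coord4)].
      e * of_complex (line_integral 1 \<gamma> (\<lambda>p. \<psi> (\<Psi> (zeta i2 i3 p))))
      + i2 * e * of_complex (line_integral 2 \<gamma> (\<lambda>p. \<psi> (\<Psi> (zeta i2 i3 p))))
      + i3 * e * of_complex (line_integral 3 \<gamma> (\<lambda>p. \<psi> (\<Psi> (zeta i2 i3 p)))))"

definition integral_dzeta_right ::
  "cquat \<Rightarrow> cquat \<Rightarrow> (real \<Rightarrow> real^3) \<Rightarrow> (cquat \<Rightarrow> cquat) \<Rightarrow> cquat" where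
  "integral_dzeta_right i2 i3 \<gamma> \<Psi> =
    (\<Sum>(e, \<psi>)\<leftarrow>[(e1, coord1), (e2, coord2), (e3, coord3), (e4, coord4)].
      e * of_complex (line_integral 1 \<gamma> (\<lambda>p. \<psi> (\<Psi> (zeta i2 i3 p))))
      + e * i2 * of_complex (line_integral 2 \<gamma> (\<lambda>p. \<psi> (\<Psi> (zeta i2 i3 p))))
      + e * i3 * of_complex (line_integral 3 \<gamma> (\<lambda>p. \<psi> (\<Psi> (zeta i2 i3 p)))))"

definition is_circle :: "real^3 \<Rightarrow> real \<Rightarrow> (real \<Rightarrow> real^3) \<Rightarrow> bool" where
  "is_circle p r c \<longleftrightarrow> r > 0 \<and>
    (\<exists>u v. norm u = 1 \<and> norm v = 1 \<and> u \<bullet> v = 0 \<and>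
      c = (\<lambda>t. p + (r * cos (2 * pi * t)) *\<^sub>R u + (r * sin (2 * pi * t)) *\<^sub>R v))"

definition circle_embraces :: "cquat \<Rightarrow> cquat \<Rightarrow> (real \<Rightarrow> real^3) \<Rightarrow> cquat \<Rightarrow> bool" where
  "circle_embraces i2 i3 c \<zeta>0 \<longleftrightarrow>
    (\<forall>f\<in>{f1, f2}. \<exists>D. open D \<and> connected D \<and>
      frontier D = f ` zeta i2 i3 ` path_image c \<and> f \<zeta>0 \<in> D)"

text \<open>The circle is required to lie in a ball contained in \<open>\<Omega>\<close>. The Cauchy formula presupposes that the curves
  $C_k$, $k = 1, 2$, bounding the plane domains around \<open>f\<^sub>k \<zeta>0\<close> are both traversed
  counterclockwise; this orientation convention is the condition on the winding numbers.\<close>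

definition embraces_once ::
  "cquat \<Rightarrow> cquat \<Rightarrow> (real^3) set \<Rightarrow> (real \<Rightarrow> real^3) \<Rightarrow> cquat \<Rightarrow> bool" where
  "embraces_once i2 i3 \<Omega> \<gamma> \<zeta>0 \<longleftrightarrow>
    (\<exists>p r c. zeta i2 i3 p = \<zeta>0 \<and> is_circle p r c \<and> cball p r \<subseteq> \<Omega> \<and>
      circle_embraces i2 i3 c \<zeta>0 \<and>
      (\<forall>f\<in>{f1, f2}. winding_number (f \<circ> zeta i2 i3 \<circ> c) (f \<zeta>0) = 1) \<and>
      homotopic_loops (\<Omega> - zeta i2 i3 -` M_set i2 i3 \<zeta>0) \<gamma> c)"

end

theory Submission
  imports Defs
begin

text \<open>
Multiplication by an element \<open>\<zeta> = \<xi>1 e1 + \<xi>2 e2\<close> of \<open>E3\<close> is diagonal in the basis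
\<open>e1, e2, e3, e4\<close>: from the left it multiplies \<open>e1\<close>, \<open>e3\<close> by \<open>\<xi>1\<close> and \<open>e2\<close>, \<open>e4\<close> by \<open>\<xi>2\<close>; from the
right it multiplies \<open>e1\<close>, \<open>e4\<close> by \<open>\<xi>1\<close> and \<open>e2\<close>, \<open>e3\<close> by \<open>\<xi>2\<close>. Therefore both Cauchy formulas
split into four scalar ones, all of the same kind. A coordinate \<open>U\<close> of the mapping is a continuous
complex function on \<open>\<Omega>\<close> whose one-sided derivative in every direction \<open>h\<close> has the form \<open>f h * d\<close>,
where \<open>f\<close> is the linear map giving \<open>\<xi>1\<close> or \<open>\<xi>2\<close>, and the claim is that the integral of
\<open>U / (f - f p)\<close> against \<open>df\<close> along \<open>\<gamma>\<close> equals \<open>2\<pi>\<i> U p\<close> (\<open>Cauchy_formula_component\<close>).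

The derivative of \<open>U\<close> vanishes along the kernel of \<open>f\<close>, and \<open>\<Omega>\<close> is convex in that direction, so \<open>U\<close> is
constant on the fibres of \<open>f\<close> and \<open>U = F \<circ> f\<close> for a function \<open>F\<close> on the plane open set \<open>f ` \<Omega>\<close>
(\<open>factors_through_linear_map\<close>). Then \<open>F\<close> is continuous and its partial derivatives exist and
satisfy the Cauchy--Riemann equations. Since the difference quotients are not assumed to converge
uniformly in the direction, complex differentiability of \<open>F\<close> is not a formality; it is the theorem
of Looman and Menchoff (\<open>Looman_Menchoff\<close>).

Once \<open>F\<close> is holomorphic, the formula is the classical one in the plane, except that the image curve
\<open>f \<circ> \<gamma>\<close> is only rectifiable and its line integrals are limits of Riemann--Stieltjes sums. These sums
differ little from the contour integrals over inscribed polygons. Fine inscribed polygons are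
homotopic to \<open>f \<circ> \<gamma>\<close>, hence to the image of the circle, inside \<open>f ` \<Omega> - {f p}\<close>
(\<open>left_sums_tendsto_contour_integral\<close>). The image of the circle lies in the convex image of a ball,
where Cauchy's formula and the winding number 1 give the value.
\<close>

section \<open>Continuous functions with bounded partial derivatives\<close>

lemma has_vector_derivative_iff_quotient:
  fixes f :: "real \<Rightarrow> 'a::real_normed_vector"
  shows "(f has_vector_derivative d) (at x within S) \<longleftrightarrow>
    ((\<lambda>y. (f y - f x) /\<^sub>R (y - x)) \<longlongrightarrow> d) (at x within S)"
proof -
  have "norm ((1 / norm (y - x)) *\<^sub>R (f y - (f x + (y - x) *\<^sub>R d)))
      = norm ((f y - f x) /\<^sub>R (y - x) - d)" if "y \<noteq> x" for y
  proof -
    have "(f y - f x) /\<^sub>R (y - x) - d = (f y - (f x + (y - x) *\<^sub>R d)) /\<^sub>R (y - x)"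
      using that by (simp add: scaleR_diff_right[of "inverse (y - x)"] diff_diff_eq[symmetric])
    then show ?thesis
      by (simp add: divide_inverse)
  qed
  then have "((\<lambda>y. norm ((1 / norm (y - x)) *\<^sub>R (f y - (f x + (y - x) *\<^sub>R d)))) \<longlongrightarrow> 0)
      (at x within S) \<longleftrightarrow>
      ((\<lambda>y. norm ((f y - f x) /\<^sub>R (y - x) - d)) \<longlongrightarrow> 0) (at x within S)"
    by (intro tendsto_cong) (auto simp: eventually_at_filter)
  then show ?thesis
    unfolding has_vector_derivative_def has_derivative_within tendsto_norm_zero_iff
    by (simp add: bounded_linear_scaleR_left Lim_null[of _ d])
qed

lemma vector_derivative_norm_bound:
  fixes f :: "real \<Rightarrow> 'a::real_normed_vector"
  assumes der: "\<And>x. x \<in> {a..b} \<Longrightarrow> (f has_vector_derivative f' x) (at x within {a..b})"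
    and K: "\<And>x. x \<in> {a..b} \<Longrightarrow> norm (f' x) \<le> K"
    and "x \<in> {a..b}" "y \<in> {a..b}"
  shows "norm (f x - f y) \<le> K * \<bar>x - y\<bar>"
proof -
  have "onorm (\<lambda>h. h *\<^sub>R f' z) \<le> K" if "z \<in> {a..b}" for z
    using K[OF that] by (intro onorm_le) (simp add: mult.commute[of K] mult_left_mono)
  then show ?thesis
    using differentiable_bound[of "{a..b}" f "\<lambda>z h. h *\<^sub>R f' z" K x y] assms
    by (auto simp: has_vector_derivative_def)
qed

text \<open>Integrating along the lower side of the rectangle and then vertically gives a function \<open>P\<close> with
\<open>\<partial>P/\<partial>y = \<i> F\<close>. That also \<open>\<partial>P/\<partial>x = F\<close> uses the bound on the partial derivatives: it permits
differentiation under the vertical integral by dominated convergence, and then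
\<open>\<i> D = \<partial>F/\<partial>y\<close> can be integrated back by the fundamental theorem of calculus for the
Henstock--Kurzweil integral, for which \<open>D\<close> may be an arbitrary derivative. So \<open>P\<close> has continuous
partial derivatives, \<open>P' = F\<close>, and \<open>F\<close> is holomorphic as a derivative.\<close>

lemma Cauchy_Riemann_bounded_imp_holomorphic:
  fixes F D :: "complex \<Rightarrow> complex"
  assumes cont: "continuous_on (cbox a b) F"
    and dx: "\<And>z. z \<in> cbox a b \<Longrightarrow> ((\<lambda>s. F (z + of_real s)) has_vector_derivative D z) (at 0)"
    and dy: "\<And>z. z \<in> cbox a b \<Longrightarrow>
      ((\<lambda>s. F (z + \<i> * of_real s)) has_vector_derivative \<i> * D z) (at 0)"
    and K: "\<And>z. z \<in> cbox a b \<Longrightarrow> norm (D z) \<le> K"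
  shows "F holomorphic_on box a b"
proof (cases "box a b = {}")
  case False
  define G where "G x y = F (Complex x y)" for x y
  define X where "X = {Re a..Re b}"
  define Y where "Y = {Im a..Im b}"
  have ab: "Re a < Re b" "Im a < Im b"
    using False by (auto simp: box_def Basis_complex_def set_eq_iff)
  have mem: "Complex x y \<in> cbox a b" if "x \<in> X" "y \<in> Y" for x y
    using that by (auto simp: X_def Y_def in_cbox_complex_iff)
  have Gx: "((\<lambda>s. G s y) has_vector_derivative D (Complex x y)) (at x)" if "x \<in> X" "y \<in> Y" for x y
  proof -
    have "((\<lambda>s. F (Complex x y + of_real s)) \<circ> (\<lambda>s. s - x) has_vector_derivative 1 *\<^sub>R D (Complex x y)) (at x)"
      using dx[OF mem[OF that]] by (intro vector_diff_chain_at) (auto intro!: derivative_eq_intros)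
    moreover have "Complex x y + of_real (s - x) = Complex s y" for s
      by (simp add: complex_eq_iff)
    then have "(\<lambda>s. F (Complex x y + of_real s)) \<circ> (\<lambda>s. s - x) = (\<lambda>s. G s y)"
      by (simp only: G_def o_def)
    ultimately show ?thesis by simp
  qed
  have Gy: "((\<lambda>s. G x s) has_vector_derivative \<i> * D (Complex x y)) (at y)" if "x \<in> X" "y \<in> Y" for x y
  proof -
    have "((\<lambda>s. F (Complex x y + \<i> * of_real s)) \<circ> (\<lambda>s. s - y) has_vector_derivative 1 *\<^sub>R (\<i> * D (Complex x y))) (at y)"
      using dy[OF mem[OF that]] by (intro vector_diff_chain_at) (auto intro!: derivative_eq_intros)
    moreover have "Complex x y + \<i> * of_real (s - y) = Complex x s" for s
      by (simp add: complex_eq_iff)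
    then have "(\<lambda>s. F (Complex x y + \<i> * of_real s)) \<circ> (\<lambda>s. s - y) = (\<lambda>s. G x s)"
      by (simp only: G_def o_def)
    ultimately show ?thesis by simp
  qed
  have contG: "continuous_on (X \<times> Y) (\<lambda>(x, y). G x y)"
  proof -
    have "continuous_on (X \<times> Y) (\<lambda>p. F (Complex (fst p) (snd p)))"
      by (rule continuous_on_compose2[OF cont])
        (auto intro!: continuous_intros mem)
    then show ?thesis by (simp add: G_def case_prod_unfold)
  qed
  have contGy: "continuous_on Y (G x)" if "x \<in> X" for x
    using Gy[OF that] by (auto intro!: continuous_at_imp_continuous_on has_vector_derivative_continuous)
  have contGx: "continuous_on X (\<lambda>x. G x y)" if "y \<in> Y" for y
    using Gx[OF _ that] by (auto intro!: continuous_at_imp_continuous_on has_vector_derivative_continuous)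
  define J where "J x y = integral {Im a..y} (G x)" for x y
  \<comment> \<open>The primitive, based at the lower left corner so that both integrals run upwards.\<close>
  define P where "P x y = integral {Re a..x} (\<lambda>s. G s (Im a)) + \<i> * J x y" for x y
  have Jx: "((\<lambda>x. \<i> * J x y) has_vector_derivative G x y - G x (Im a)) (at x within X)"
    if "x \<in> X" "y \<in> Y" for x y
  proof -
    let ?T = "{Im a..y}"
    have T: "?T \<subseteq> Y" using that by (auto simp: Y_def)
    have int: "G s integrable_on ?T" if "s \<in> X" for s
      using contGy[OF that] T by (meson continuous_on_subset integrable_continuous_real)
    have ftc: "((\<lambda>t. \<i> * D (Complex x t)) has_integral G x y - G x (Im a)) ?T"
      using Gy[OF \<open>x \<in> X\<close>] T \<open>y \<in> Y\<close>
      by (intro fundamental_theorem_of_calculus) (auto simp: Y_def intro: has_vector_derivative_at_within)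
    have "((\<lambda>s. (J s y - J x y) /\<^sub>R (s - x)) \<longlongrightarrow> integral ?T (\<lambda>t. D (Complex x t))) (at x within X)"
      unfolding tendsto_at_iff_sequentially
    proof (intro allI impI)
      fix S assume S: "\<forall>i. S i \<in> X - {x}" "S \<longlonglongrightarrow> x"
      have "(\<lambda>k. integral ?T (\<lambda>t. (G (S k) t - G x t) /\<^sub>R (S k - x)))
          \<longlonglongrightarrow> integral ?T (\<lambda>t. D (Complex x t))"
      proof (rule dominated_convergence(2)[where h = "\<lambda>_. K"])
        show "(\<lambda>t. (G (S k) t - G x t) /\<^sub>R (S k - x)) integrable_on ?T" for k
          using S int \<open>x \<in> X\<close> by (intro integrable_cmul integrable_diff) auto
        show "(\<lambda>_. K) integrable_on ?T" by (rule integrable_const_ivl)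
        fix t assume t: "t \<in> ?T"
        then have tY: "t \<in> Y" using T by auto
        show "norm ((G (S k) t - G x t) /\<^sub>R (S k - x)) \<le> K" for k
        proof -
          have "norm (G (S k) t - G x t) \<le> K * \<bar>S k - x\<bar>"
            using has_vector_derivative_at_within[OF Gx[OF _ tY]] K[OF mem[OF _ tY]] S \<open>x \<in> X\<close>
            by (intro vector_derivative_norm_bound[where a = "Re a" and b = "Re b"
                  and f = "\<lambda>x. G x t" and f' = "\<lambda>x. D (Complex x t)"])
               (auto simp: X_def)
          moreover have "\<bar>S k - x\<bar> > 0" using S by simp
          ultimately show ?thesis
            by (simp add: divide_inverse[symmetric] pos_divide_le_eq mult.commute[of "inverse _"])
        qed
        have "(\<lambda>s. (G s t - G x t) /\<^sub>R (s - x)) \<midarrow>x\<rightarrow> D (Complex x t)"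
          using Gx[OF \<open>x \<in> X\<close>, of t] t T by (auto simp: has_vector_derivative_iff_quotient)
        then show "(\<lambda>k. (G (S k) t - G x t) /\<^sub>R (S k - x)) \<longlonglongrightarrow> D (Complex x t)"
          using S by (auto simp: tendsto_at_iff_sequentially o_def)
      qed
      moreover have "integral ?T (\<lambda>t. (G (S k) t - G x t) /\<^sub>R (S k - x))
          = (J (S k) y - J x y) /\<^sub>R (S k - x)" for k
        using S int \<open>x \<in> X\<close> by (simp add: J_def integral_diff)
      ultimately show "((\<lambda>s. (J s y - J x y) /\<^sub>R (s - x)) \<circ> S) \<longlonglongrightarrow> integral ?T (\<lambda>t. D (Complex x t))"
        by (simp only: o_def)
    qed
    then have "((\<lambda>x. J x y) has_vector_derivative integral ?T (\<lambda>t. D (Complex x t))) (at x within X)"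
      by (simp add: has_vector_derivative_iff_quotient)
    then have "((\<lambda>x. \<i> * J x y) has_vector_derivative \<i> * integral ?T (\<lambda>t. D (Complex x t))) (at x within X)"
      by (rule has_vector_derivative_mult_right)
    moreover have "\<i> * integral ?T (\<lambda>t. D (Complex x t)) = G x y - G x (Im a)"
      using integral_unique[OF ftc] by simp
    ultimately show ?thesis by simp
  qed
  have Px: "((\<lambda>x. P x y) has_vector_derivative G x y) (at x within X)" if "x \<in> X" "y \<in> Y" for x y
  proof -
    have "((\<lambda>x. integral {Re a..x} (\<lambda>s. G s (Im a))) has_vector_derivative G x (Im a)) (at x within X)"
      using contGx[of "Im a"] that ab unfolding X_def
      by (intro integral_has_vector_derivative) (auto simp: Y_def)
    from has_vector_derivative_add[OF this Jx[OF that]] show ?thesis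
      by (simp add: P_def)
  qed
  have Py: "((\<lambda>y. P x y) has_vector_derivative \<i> * G x y) (at y within Y)" if "x \<in> X" "y \<in> Y" for x y
  proof -
    have "((\<lambda>y. J x y) has_vector_derivative G x y) (at y within Y)"
      using contGy[of x] that unfolding Y_def J_def
      by (intro integral_has_vector_derivative) auto
    then have "((\<lambda>y. \<i> * J x y) has_vector_derivative \<i> * G x y) (at y within Y)"
      by (rule has_vector_derivative_mult_right)
    from has_vector_derivative_add[OF has_vector_derivative_const this] show ?thesis
      by (simp add: P_def)
  qed
  have "((\<lambda>z. P (Re z) (Im z)) has_field_derivative F z) (at z)" if z: "z \<in> box a b" for z
  proof -
    have zXY: "Re z \<in> X" "Im z \<in> Y"
      using z by (auto simp: X_def Y_def in_box_complex_iff)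
    have "((\<lambda>(x, y). P x y) has_derivative (\<lambda>(tx, ty). tx *\<^sub>R G (Re z) (Im z)
         + blinfun_apply (blinfun_scaleR_left (\<i> * G (Re z) (Im z))) ty)) (at (Re z, Im z) within X \<times> Y)"
    proof (rule has_derivative_partialsI[where fy = "\<lambda>x y. blinfun_scaleR_left (\<i> * G x y)"])
      have "continuous_on (X \<times> Y) (\<lambda>p. blinfun_scaleR_left (\<i> * (case p of (x, y) \<Rightarrow> G x y)))"
        by (intro bounded_linear.continuous_on[OF bounded_linear_blinfun_scaleR_left]
            continuous_intros contG)
      then show "continuous (at (Re z, Im z) within X \<times> Y) (\<lambda>(x, y). blinfun_scaleR_left (\<i> * G x y))"
        using zXY by (auto simp: continuous_on_eq_continuous_within case_prod_unfold)
      show "convex Y" by (simp add: Y_def)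
    qed (use Px Py zXY in \<open>auto simp: has_vector_derivative_def\<close>)
    moreover have "(\<lambda>w. (Re w, Im w)) ` box a b \<subseteq> X \<times> Y"
      by (auto simp: X_def Y_def in_box_complex_iff)
    ultimately have "((\<lambda>(x, y). P x y) has_derivative (\<lambda>(tx, ty). tx *\<^sub>R G (Re z) (Im z)
         + blinfun_apply (blinfun_scaleR_left (\<i> * G (Re z) (Im z))) ty))
         (at (Re z, Im z) within (\<lambda>w. (Re w, Im w)) ` box a b)"
      by (rule has_derivative_subset)
    moreover have "((\<lambda>w. (Re w, Im w)) has_derivative (\<lambda>h. (Re h, Im h))) (at z within box a b)"
      by (auto intro!: derivative_eq_intros)
    ultimately have "((\<lambda>w. case (Re w, Im w) of (x, y) \<Rightarrow> P x y) has_derivative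
       (\<lambda>h. case (Re h, Im h) of (tx, ty) \<Rightarrow> tx *\<^sub>R G (Re z) (Im z)
         + blinfun_apply (blinfun_scaleR_left (\<i> * G (Re z) (Im z))) ty)) (at z within box a b)"
      by (rule has_derivative_in_compose[rotated])
    moreover have "(\<lambda>h. case (Re h, Im h) of (tx, ty) \<Rightarrow> tx *\<^sub>R G (Re z) (Im z)
         + blinfun_apply (blinfun_scaleR_left (\<i> * G (Re z) (Im z))) ty) = (*) (F z)"
      by (auto simp: fun_eq_iff G_def complex_eq_iff algebra_simps)
    ultimately show ?thesis
      using z by (simp add: has_field_derivative_def at_within_open[OF _ open_box])
  qed
  then have "(\<lambda>z. P (Re z) (Im z)) holomorphic_on box a b"
    and "\<And>z. z \<in> box a b \<Longrightarrow> deriv (\<lambda>z. P (Re z) (Im z)) z = F z"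
    by (simp_all add: holomorphic_on_open open_box DERIV_imp_deriv) blast
  then show ?thesis
    by (metis holomorphic_deriv open_box holomorphic_transform)
qed (simp add: holomorphic_on_def)

section \<open>The Looman--Menchoff theorem\<close>

text \<open>The obstacle to the maximum modulus principle for the difference quotient of \<open>F\<close> at \<open>z\<close> is its
singularity at \<open>z\<close>, near which, away from \<open>E\<close> and the ray, nothing but the continuity of \<open>F\<close> is
known. Cutting the plane along the ray and substituting \<open>w = z + v\<^sup>2\<close> opens it to the half plane
\<open>Im v > 0\<close>. There the singular factor \<open>1 / v\<^sup>2\<close> may be replaced by \<open>1 / (v + \<i> \<eta>)\<^sup>2\<close>, which is regular
and, because \<open>\<bar>v + \<i> \<eta>\<bar> \<ge> \<bar>v\<bar>\<close>, smaller. The principle applies to the regularised quotient, and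
\<open>\<eta>\<close> tends to 0.\<close>

lemma Lipschitz_bound_off_slit:
  fixes F :: "complex \<Rightarrow> complex"
  assumes holo: "F holomorphic_on ball c r - E" and E: "closedin (top_of_set (ball c r)) E"
    and cont: "continuous_on (cball c r) F" and "0 \<le> K"
    and zE: "z \<in> E" 
    and on_E: "\<And>w. w \<in> E \<Longrightarrow> norm (F w - F z) \<le> K * norm (w - z)"
    and on_sphere: "\<And>w. w \<in> sphere c r \<Longrightarrow> norm (F w - F z) \<le> K * norm (w - z)"
    and on_ray: "\<And>s. 0 \<le> s \<Longrightarrow> z + of_real s \<in> ball c r \<Longrightarrow> norm (F (z + of_real s) - F z) \<le> K * s"
    and w: "w \<in> ball c r"
  shows "norm (F w - F z) \<le> K * norm (w - z)"
proof -
  define V where "V = {v. Im v > 0 \<and> z + v\<^sup>2 \<in> ball c r - E}"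
  have "open (ball c r - E)"
    using E by (metis open_ball openin_open_eq openin_diff openin_subtopology_self)
  moreover have "V = {v. Im v > 0} \<inter> (\<lambda>v. z + v\<^sup>2) -` (ball c r - E)"
    by (auto simp: V_def)
  ultimately have "open V"
    by (auto intro!: open_Int open_vimage open_halfspace_Im_gt continuous_intros)
  have clV: "Im v \<ge> 0 \<and> z + v\<^sup>2 \<in> cball c r" if "v \<in> closure V" for v
  proof -
    have "closed ({v. Im v \<ge> 0} \<inter> (\<lambda>v. z + v\<^sup>2) -` cball c r)"
      by (intro closed_Int closed_vimage closed_halfspace_Im_ge continuous_intros closed_cball)
    moreover have "V \<subseteq> {v. Im v \<ge> 0} \<inter> (\<lambda>v. z + v\<^sup>2) -` cball c r"
      by (auto simp: V_def)
    ultimately show ?thesis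
      using closure_minimal that by blast
  qed
  have "bounded V"
  proof -
    have "norm v \<le> 1 + norm (z - c) + r" if "v \<in> V" for v
    proof (rule ccontr)
      assume less: "\<not> ?thesis"
      have "norm (v\<^sup>2) \<le> norm (z - c) + r"
        using that norm_triangle_ineq4[of "z + v\<^sup>2 - c" "z - c"] by (auto simp: V_def dist_norm norm_minus_commute)
      moreover have "0 \<le> norm (z - c) + r" using calculation norm_ge_zero order_trans by blast
      then have "norm v * 1 \<le> norm v * norm v"
        using less by (intro mult_left_mono) auto
      ultimately show False
        using less by (simp add: norm_mult power2_eq_square)
    qed
    then show ?thesis by (auto simp: bounded_iff)
  qed
  have bound: "norm (F w - F z) \<le> K * (norm v + \<eta>)\<^sup>2"
    if v: "v \<in> V" "w = z + v\<^sup>2" and \<eta>: "\<eta> > 0" for v \<eta>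
  proof -
    \<comment> \<open>The exact quotient would have \<open>u\<^sup>2\<close> in the denominator; the shift by \<open>\<i> \<eta>\<close> keeps it away from 0
      on the closed half plane.\<close>
    define h where "h u = (F (z + u\<^sup>2) - F z) / (u + \<i> * of_real \<eta>)\<^sup>2" for u
    have nz: "u + \<i> * of_real \<eta> \<noteq> 0" if "Im u \<ge> 0" for u
      using that \<eta> by (auto simp: complex_eq_iff)
    have "norm (h v) \<le> K"
    proof (rule maximum_modulus_frontier[where S = V and f = h and \<xi> = v])
      show "h holomorphic_on interior V"
        unfolding h_def interior_open[OF \<open>open V\<close>]
      proof (intro holomorphic_intros)
        show "(\<lambda>u. F (z + u\<^sup>2)) holomorphic_on V"
          by (rule holomorphic_on_compose_gen[OF _ holo, unfolded o_def])
            (auto simp: V_def intro!: holomorphic_intros)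
      qed (use nz in \<open>auto simp: V_def\<close>)
      show "continuous_on (closure V) h"
        unfolding h_def
      proof (intro continuous_intros)
        show "continuous_on (closure V) (\<lambda>u. F (z + u\<^sup>2))"
          by (rule continuous_on_compose2[OF cont]) (auto intro!: continuous_intros dest: clV)
      qed (use clV nz in auto)
      show "bounded V" by fact
      fix u assume "u \<in> frontier V"
      then have u: "u \<in> closure V" "u \<notin> V"
        using \<open>open V\<close> by (auto simp: frontier_def interior_open)
      have im: "Im u \<ge> 0" and cb: "z + u\<^sup>2 \<in> cball c r"
        using clV[OF u(1)] by auto
      have "norm (F (z + u\<^sup>2) - F z) \<le> K * (norm u)\<^sup>2"
      proof (cases "z + u\<^sup>2 \<in> ball c r")
        case False
        then have "z + u\<^sup>2 \<in> sphere c r" using cb by auto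
        from on_sphere[OF this] show ?thesis by (simp add: norm_power)
      next
        case True
        show ?thesis
        proof (cases "z + u\<^sup>2 \<in> E")
          case True
          from on_E[OF this] show ?thesis by (simp add: norm_power)
        next
          case False
          then have "Im u = 0"
            using u(2) True im by (auto simp: V_def)
          then have u2: "u\<^sup>2 = of_real ((norm u)\<^sup>2)"
            by (simp add: complex_eq_iff norm_complex_def power2_eq_square)
          show ?thesis
            using on_ray[of "(norm u)\<^sup>2"] True unfolding u2 by simp
        qed
      qed
      also have "\<dots> \<le> K * (norm (u + \<i> * of_real \<eta>))\<^sup>2"
      proof -
        have "norm u \<le> norm (u + \<i> * of_real \<eta>)"
          using im \<eta> by (auto simp: norm_complex_def intro!: real_sqrt_le_mono power_mono)
        then show ?thesis
          using \<open>0 \<le> K\<close> by (intro mult_left_mono power_mono) auto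
      qed
      finally show "norm (h u) \<le> K"
        using nz[OF im] by (simp add: h_def norm_divide norm_power divide_le_eq)
    qed (use v in auto)
    moreover have "v + \<i> * of_real \<eta> \<noteq> 0" using v nz by (auto simp: V_def)
    ultimately have "norm (F w - F z) \<le> K * norm (v + \<i> * of_real \<eta>) ^ 2"
      using v by (simp add: h_def norm_divide norm_power divide_le_eq)
    also have "\<dots> \<le> K * (norm v + \<eta>)\<^sup>2"
      using norm_triangle_ineq[of v "\<i> * of_real \<eta>"] \<eta> \<open>0 \<le> K\<close>
      by (intro mult_left_mono power_mono) (auto simp: norm_mult)
    finally show ?thesis .
  qed
  \<comment> \<open>Of the two square roots the one in the closed upper half plane; it is real exactly on the ray.\<close>
  obtain v where v: "w - z = v\<^sup>2" "Im v \<ge> 0"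
  proof -
    have "(csqrt (w - z))\<^sup>2 = w - z" "(- csqrt (w - z))\<^sup>2 = w - z" by simp_all
    then show ?thesis using that[of "csqrt (w - z)"] that[of "- csqrt (w - z)"]
      by (cases "Im (csqrt (w - z)) \<ge> 0") auto
  qed
  then have wv: "w = z + v\<^sup>2" by (simp add: algebra_simps)
  have "w \<in> E \<or> Im v = 0 \<and> w \<notin> E \<or> v \<in> V"
    using v(2) w unfolding V_def wv by force
  then consider "w \<in> E" | "Im v = 0" "w \<notin> E" | "v \<in> V"
    by blast
  then show ?thesis
  proof cases
    case 1
    then show ?thesis by (rule on_E)
  next
    case 2
    then have u2: "v\<^sup>2 = of_real ((norm v)\<^sup>2)"
      by (simp add: complex_eq_iff norm_complex_def power2_eq_square)
    show ?thesis
      using on_ray[of "(norm v)\<^sup>2"] w wv u2 by (simp add: norm_power)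
  next
    case 3
    have "((\<lambda>\<eta>. K * (norm v + \<eta>)\<^sup>2) \<longlongrightarrow> K * (norm v + 0)\<^sup>2) (at_right 0)"
      by (intro tendsto_intros)
    moreover have "\<forall>\<^sub>F \<eta> in at_right 0. norm (F w - F z) \<le> K * (norm v + \<eta>)\<^sup>2"
      using bound[OF 3 wv] by (auto simp: eventually_at_right_less eventually_at_filter intro!: always_eventually)
    ultimately have "norm (F w - F z) \<le> K * (norm v + 0)\<^sup>2"
      by (rule tendsto_lowerbound) auto
    then show ?thesis using v by (simp add: norm_power)
  qed
qed

lemma has_vector_derivative_local_bound:
  fixes g :: "real \<Rightarrow> 'a::real_normed_vector"
  assumes "(g has_vector_derivative d) (at 0)"
  obtains \<delta> where "\<delta> > 0" "\<And>t. \<bar>t\<bar> < \<delta> \<Longrightarrow> norm (g t - g 0) \<le> (norm d + 1) * \<bar>t\<bar>"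
proof -
  obtain \<delta> where \<delta>: "\<delta> > 0" "\<And>t. \<bar>t\<bar> < \<delta> \<Longrightarrow> norm (g t - g 0 - t *\<^sub>R d) \<le> \<bar>t\<bar>"
  proof -
    have "\<exists>\<delta>>0. \<forall>y\<in>UNIV. norm (y - 0) < \<delta> \<longrightarrow> norm (g y - g 0 - (y - 0) *\<^sub>R d) \<le> 1 * norm (y - 0)"
      using assms unfolding has_vector_derivative_def has_derivative_within_alt by (blast intro: zero_less_one)
    then show ?thesis using that by auto
  qed
  have "norm (g t - g 0) \<le> (norm d + 1) * \<bar>t\<bar>" if "\<bar>t\<bar> < \<delta>" for t
    using \<delta>(2)[OF that] norm_triangle_ineq[of "g t - g 0 - t *\<^sub>R d" "t *\<^sub>R d"]
    by (simp add: algebra_simps)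
  with \<delta>(1) show ?thesis by (rule that)
qed

lemma norm_vector_derivative_le:
  fixes g :: "real \<Rightarrow> 'a::real_normed_vector"
  assumes der: "(g has_vector_derivative d) (at 0)"
    and "\<delta> > 0" and bd: "\<And>t. \<bar>t\<bar> < \<delta> \<Longrightarrow> norm (g t - g 0) \<le> K * \<bar>t\<bar>"
  shows "norm d \<le> K"
proof (rule tendsto_upperbound)
  show "((\<lambda>t. norm ((g t - g 0) /\<^sub>R (t - 0))) \<longlongrightarrow> norm d) (at 0)"
    using der unfolding has_vector_derivative_iff_quotient by (rule tendsto_norm)
  show "\<forall>\<^sub>F t in at 0. norm ((g t - g 0) /\<^sub>R (t - 0)) \<le> K"
    unfolding eventually_at
    using \<open>\<delta> > 0\<close> bd by (auto simp: divide_inverse[symmetric] pos_divide_le_eq mult.commute[of "inverse _"] intro!: exI[of _ \<delta>])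
qed auto

text \<open>The bounds on the horizontal and vertical difference quotients near a point depend on the point. The
sets where they hold with a given constant on a given scale are closed, and countably many of them
cover a compact part of \<open>E\<close>; by Baire's theorem one of them contains a relatively open part of \<open>E\<close>.\<close>

lemma axis_Lipschitz_on_portion:
  fixes F D1 D2 :: "complex \<Rightarrow> complex"
  assumes "open W" and cont: "continuous_on W F"
    and dx: "\<And>z. z \<in> W \<Longrightarrow> ((\<lambda>s. F (z + of_real s)) has_vector_derivative D1 z) (at 0)"
    and dy: "\<And>z. z \<in> W \<Longrightarrow> ((\<lambda>s. F (z + \<i> * of_real s)) has_vector_derivative D2 z) (at 0)"
    and E: "closedin (top_of_set W) E" "E \<noteq> {}"
  obtains c r N where "c \<in> E" "r > 0" "N \<ge> 0" "cball c r \<subseteq> W"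
    "\<And>z w. z \<in> E \<inter> ball c r \<Longrightarrow> norm (w - z) \<le> 2 * r \<Longrightarrow> Im w = Im z \<or> Re w = Re z \<Longrightarrow>
       norm (F w - F z) \<le> N * norm (w - z)"
proof -
  obtain c0 where c0: "c0 \<in> E" using E by auto
  have "E \<subseteq> W" using E(1) closedin_subset by fastforce
  obtain R' where R': "R' > 0" "cball c0 R' \<subseteq> W"
    using \<open>open W\<close> c0 \<open>E \<subseteq> W\<close> open_contains_cball by blast
  define R where "R = R' / 2"
  have R: "R > 0" "cball c0 (2 * R) \<subseteq> W" using R' by (auto simp: R_def)
  \<comment> \<open>Baire's theorem needs a closed set. The closure of the part of \<open>E\<close> in the open ball, and not the
    part in the closed ball, ensures that an open set meeting \<open>S\<close> also meets \<open>E\<close> inside the ball.\<close>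
  define S where "S = closure (E \<inter> ball c0 R)"
  have "S \<subseteq> E \<inter> cball c0 R"
  proof -
    obtain T where T: "closed T" "E = W \<inter> T"
      using E(1) by (auto simp: closedin_closed)
    then have "E \<inter> cball c0 R = T \<inter> cball c0 R"
      using R by auto
    with T have "closed (E \<inter> cball c0 R)" by (metis closed_Int closed_cball)
    then show ?thesis unfolding S_def by (rule closure_minimal[rotated]) auto
  qed
  define A where "A n = {z. \<forall>t::real. \<bar>t\<bar> \<le> R / Suc n \<longrightarrow>
     norm (F (z + of_real t) - F z) \<le> Suc n * \<bar>t\<bar> \<and> norm (F (z + \<i> * of_real t) - F z) \<le> Suc n * \<bar>t\<bar>}" for n
  have inW: "z + of_real t \<in> W" "z + \<i> * of_real t \<in> W"
    if "z \<in> cball c0 R" "\<bar>t\<bar> \<le> R / Suc n" for z t n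
  proof -
    have "R / Suc n \<le> R" using R by (simp add: divide_le_eq)
    then have "\<bar>t\<bar> \<le> R" using that by linarith
    then have "dist c0 (z + of_real t) \<le> 2 * R" "dist c0 (z + \<i> * of_real t) \<le> 2 * R"
      using that dist_triangle[of c0 "z + of_real t" z] dist_triangle[of c0 "z + \<i> * of_real t" z]
      by (auto simp: dist_norm norm_mult)
    then show "z + of_real t \<in> W" "z + \<i> * of_real t \<in> W" using R by auto
  qed
  have clA: "closed (S \<inter> A n)" for n
  proof -
    define T where "T = {t :: real. \<bar>t\<bar> \<le> R / Suc n}"
    define B where "B p = {z \<in> S. norm (F (z + snd p * of_real (fst p)) - F z) \<le> Suc n * \<bar>fst p\<bar>}"
      for p :: "real \<times> complex"
    have "closed (B p)" if p: "p \<in> T \<times> {1, \<i>}" for p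
      unfolding B_def
    proof (rule continuous_on_closed_Collect_le)
      have "continuous_on S (\<lambda>z. F (z + snd p * of_real (fst p)))"
        by (rule continuous_on_compose2[OF cont])
           (use inW[of _ "fst p" n] p \<open>S \<subseteq> E \<inter> cball c0 R\<close> in \<open>auto simp: T_def intro!: continuous_intros\<close>)
      moreover have "continuous_on S F"
        using cont by (rule continuous_on_subset) (use \<open>S \<subseteq> E \<inter> cball c0 R\<close> \<open>E \<subseteq> W\<close> in auto)
      ultimately show "continuous_on S (\<lambda>z. norm (F (z + snd p * of_real (fst p)) - F z))"
        by (intro continuous_intros)
    qed (auto simp: S_def)
    then have "closed (S \<inter> (\<Inter>p\<in>T \<times> {1, \<i>}. B p))"
      by (intro closed_Int closed_INT) (auto simp: S_def)
    also have "S \<inter> (\<Inter>p\<in>T \<times> {1, \<i>}. B p) = S \<inter> A n"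
      by (auto simp: A_def B_def T_def)
    finally show ?thesis .
  qed
  have cover: "\<exists>n. z \<in> A n" if "z \<in> S" for z
  proof -
    have "z \<in> W" using that \<open>S \<subseteq> E \<inter> cball c0 R\<close> \<open>E \<subseteq> W\<close> by auto
    obtain \<delta>1 where \<delta>1: "\<delta>1 > 0"
      "\<And>t. \<bar>t\<bar> < \<delta>1 \<Longrightarrow> norm (F (z + of_real t) - F z) \<le> (norm (D1 z) + 1) * \<bar>t\<bar>"
      using has_vector_derivative_local_bound[OF dx[OF \<open>z \<in> W\<close>]] by auto
    obtain \<delta>2 where \<delta>2: "\<delta>2 > 0"
      "\<And>t. \<bar>t\<bar> < \<delta>2 \<Longrightarrow> norm (F (z + \<i> * of_real t) - F z) \<le> (norm (D2 z) + 1) * \<bar>t\<bar>"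
      using has_vector_derivative_local_bound[OF dy[OF \<open>z \<in> W\<close>]] by auto
    obtain n :: nat where n: "max (norm (D1 z) + 1) (max (norm (D2 z) + 1) (R / min \<delta>1 \<delta>2)) < n"
      using reals_Archimedean2 by blast
    have pos: "min \<delta>1 \<delta>2 > 0" using \<delta>1 \<delta>2 by simp
    have "R < n * min \<delta>1 \<delta>2" using n pos by (simp add: pos_divide_less_eq)
    also have "\<dots> \<le> Suc n * min \<delta>1 \<delta>2" using pos by (intro mult_right_mono) auto
    finally have "R / Suc n < min \<delta>1 \<delta>2"
      by (subst pos_divide_less_eq) (simp_all add: mult.commute)
    then have n': "norm (D1 z) + 1 \<le> Suc n" "norm (D2 z) + 1 \<le> Suc n" "R / Suc n < min \<delta>1 \<delta>2"
      using n by simp_all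
    have "z \<in> A n"
      unfolding A_def
    proof (intro CollectI allI impI)
      fix t :: real assume t: "\<bar>t\<bar> \<le> R / Suc n"
      with n' have "\<bar>t\<bar> < \<delta>1" "\<bar>t\<bar> < \<delta>2" by auto
      then show "norm (F (z + of_real t) - F z) \<le> Suc n * \<bar>t\<bar> \<and>
          norm (F (z + \<i> * of_real t) - F z) \<le> Suc n * \<bar>t\<bar>"
        using \<delta>1(2)[of t] \<delta>2(2)[of t] mult_right_mono[OF n'(1), of "\<bar>t\<bar>"] mult_right_mono[OF n'(2), of "\<bar>t\<bar>"]
        by linarith
    qed
    then show ?thesis ..
  qed
  have "\<exists>n. \<not> S \<subseteq> closure (S - A n)"
  proof (rule ccontr)
    assume "\<not> ?thesis"
    then have dense: "S \<subseteq> closure (S - A n)" for n by blast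
    have "S \<subseteq> closure (\<Inter>n. S - A n)"
    proof (rule Baire)
      show "closed S" by (simp add: S_def)
      fix T assume "T \<in> range (\<lambda>n. S - A n)"
      then obtain n where T: "T = S - A n" by auto
      have "S - A n = S - (S \<inter> A n)" by auto
      then have "openin (top_of_set S) (S - A n)"
        using clA[of n] by (metis closed_subset inf_le1 openin_diff openin_subtopology_self)
      then show "openin (top_of_set S) T \<and> S \<subseteq> closure T"
        using dense T by blast
    qed auto
    moreover have "(\<Inter>n. S - A n) = {}" using cover by auto
    moreover have "c0 \<in> S" unfolding S_def using c0 R by (intro closure_subset[THEN subsetD]) auto
    ultimately show False by (metis closure_empty empty_iff subsetD)
  qed
  then obtain n x where x: "x \<in> S" "x \<notin> closure (S - A n)" by blast
  define U where "U = - closure (S - A n)"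
  have "open U" "x \<in> U" using x by (auto simp: U_def)
  then have "U \<inter> (E \<inter> ball c0 R) \<noteq> {}"
    using x(1) open_Int_closure_eq_empty[OF \<open>open U\<close>, of "E \<inter> ball c0 R"] unfolding S_def by blast
  then obtain c where c: "c \<in> U" "c \<in> E" "c \<in> ball c0 R" by auto
  have "open (U \<inter> ball c0 R)" "c \<in> U \<inter> ball c0 R" using \<open>open U\<close> c by auto
  then obtain r0 where r0: "r0 > 0" "ball c r0 \<subseteq> U \<inter> ball c0 R"
    using open_contains_ball by blast
  define r where "r = min r0 (R / Suc n / 2)"
  have "r \<le> R / Suc n / 2" unfolding r_def by (rule min.cobounded2)
  moreover have "2 * x \<le> y" if "x \<le> y / 2" for x y :: real using that by linarith
  ultimately have "2 * r \<le> R / Suc n" by blast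
  moreover have "r > 0" "r \<le> r0" using r0 R by (simp_all add: r_def)
  ultimately have r: "r > 0" "r \<le> r0" "2 * r \<le> R / Suc n" by blast+
  show ?thesis
  proof
    show "c \<in> E" "r > 0" by fact+
    show "real (Suc n) \<ge> 0" by simp
    have "R / Suc n \<le> R" using R by (simp add: divide_le_eq)
    then have "r \<le> R" using r by linarith
    show "cball c r \<subseteq> W"
    proof
      fix w assume "w \<in> cball c r"
      then have "dist c0 w \<le> 2 * R"
        using dist_triangle[of c0 w c] c \<open>r \<le> R\<close> by auto
      then show "w \<in> W" using R by auto
    qed
    fix z w assume z: "z \<in> E \<inter> ball c r" and w: "norm (w - z) \<le> 2 * r" "Im w = Im z \<or> Re w = Re z"
    have "z \<in> ball c r0" using z r by auto
    then have "z \<in> U \<inter> ball c0 R" using r0 by blast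
    moreover have "z \<in> S"
      using calculation z unfolding S_def by (intro closure_subset[THEN subsetD]) auto
    ultimately have "z \<in> A n"
      unfolding U_def using closure_subset[of "S - A n"] by auto
    have *: "norm (F (z + of_real t) - F z) \<le> Suc n * \<bar>t\<bar>"
        "norm (F (z + \<i> * of_real t) - F z) \<le> Suc n * \<bar>t\<bar>" if "\<bar>t\<bar> \<le> 2 * r" for t :: real
      using \<open>z \<in> A n\<close> that r(3) by (auto simp: A_def)
    from w(2) show "norm (F w - F z) \<le> real (Suc n) * norm (w - z)"
    proof
      assume "Im w = Im z"
      then have "w = z + of_real (Re w - Re z)" "norm (w - z) = \<bar>Re w - Re z\<bar>"
        by (auto simp: complex_eq_iff norm_complex_def)
      then show ?thesis using *(1)[of "Re w - Re z"] w(1) by simp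
    next
      assume "Re w = Re z"
      then have "w = z + \<i> * of_real (Im w - Im z)" "norm (w - z) = \<bar>Im w - Im z\<bar>"
        by (auto simp: complex_eq_iff norm_complex_def)
      then show ?thesis using *(2)[of "Im w - Im z"] w(1) by simp
    qed
  qed
qed

text \<open>Let \<open>E\<close> be the set of points without a neighbourhood on which \<open>F\<close> is holomorphic. If it were not
empty, then near some point of \<open>E\<close> the function \<open>F\<close> would satisfy a Lipschitz condition at the points
of \<open>E\<close> along the axes, hence (passing through the corner of a rectangle) on \<open>E\<close> itself, hence by
\<open>Lipschitz_bound_off_slit\<close> from the points of \<open>E\<close> to all nearby points. Cauchy's inequality on the
largest disc that avoids \<open>E\<close> then bounds \<open>F'\<close> off \<open>E\<close>, and on \<open>E\<close> the Lipschitz condition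
does, so all partial derivatives are bounded near the point and \<open>F\<close> is holomorphic there after all.\<close>

theorem Looman_Menchoff:
  fixes F D :: "complex \<Rightarrow> complex"
  assumes "open W" and cont: "continuous_on W F"
    and dx: "\<And>z. z \<in> W \<Longrightarrow> ((\<lambda>s. F (z + of_real s)) has_vector_derivative D z) (at 0)"
    and dy: "\<And>z. z \<in> W \<Longrightarrow>
      ((\<lambda>s. F (z + \<i> * of_real s)) has_vector_derivative \<i> * D z) (at 0)"
  shows "F holomorphic_on W"
proof -
  define H where "H = \<Union>{V. open V \<and> V \<subseteq> W \<and> F holomorphic_on V}"
  define E where "E = W - H"
  have "open H" unfolding H_def by (rule open_Union) blast
  have "H \<subseteq> W" unfolding H_def by blast
  have "F holomorphic_on (\<Union>V\<in>{V. open V \<and> V \<subseteq> W \<and> F holomorphic_on V}. V)"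
    by (rule holomorphic_on_UN_open) blast+
  then have holH: "F holomorphic_on H"
    unfolding H_def image_ident .
  have "E = {}"
  proof (rule ccontr)
    assume "E \<noteq> {}"
    have "E = W \<inter> - H" by (auto simp: E_def)
    with \<open>open H\<close> have clE: "closedin (top_of_set W) E"
      by (metis closed_Compl closedin_closed_Int)
    obtain c r N where c: "c \<in> E" "r > 0" "N \<ge> 0" "cball c r \<subseteq> W"
      and N: "\<And>z w. z \<in> E \<inter> ball c r \<Longrightarrow> norm (w - z) \<le> 2 * r \<Longrightarrow> Im w = Im z \<or> Re w = Re z \<Longrightarrow>
         norm (F w - F z) \<le> N * norm (w - z)"
      using axis_Lipschitz_on_portion[OF \<open>open W\<close> cont dx dy clE \<open>E \<noteq> {}\<close>] by blast
    have ballW: "ball c r \<subseteq> W" using c(4) ball_subset_cball by blast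
    have contc: "continuous_on (cball c r) F"
      using cont c(4) by (rule continuous_on_subset)
    have lipE: "norm (F w - F z) \<le> 2 * N * norm (w - z)" if "z \<in> E \<inter> ball c r" "w \<in> E \<inter> ball c r" for z w
    proof -
      \<comment> \<open>The corner joining \<open>z\<close> horizontally and \<open>w\<close> vertically need not lie in \<open>E\<close>.\<close>
      define q where "q = Complex (Re w) (Im z)"
      have le: "norm (q - z) \<le> norm (w - z)" "norm (q - w) \<le> norm (w - z)"
        by (auto simp: q_def norm_complex_def power2_commute[of "Im z"] intro!: real_sqrt_le_mono)
      moreover have "norm (w - z) \<le> 2 * r"
        using that norm_triangle_ineq4[of "w - c" "z - c"] by (auto simp: dist_norm norm_minus_commute)
      ultimately have "norm (F q - F z) \<le> N * norm (q - z)" "norm (F q - F w) \<le> N * norm (q - w)"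
        using N[OF that(1), of q] N[OF that(2), of q] by (auto simp: q_def)
      moreover have "N * norm (q - z) \<le> N * norm (w - z)" "N * norm (q - w) \<le> N * norm (w - z)"
        using le c(3) by (auto intro: mult_left_mono)
      ultimately show ?thesis
        using norm_triangle_ineq4[of "F q - F z" "F q - F w"] by simp
    qed
    obtain M where M: "\<And>w. w \<in> cball c r \<Longrightarrow> norm (F w) \<le> M"
      using compact_imp_bounded[OF compact_continuous_image[OF contc compact_cball]]
      unfolding bounded_iff by (metis imageI)
    \<comment> \<open>The second constant serves on the sphere, which is at distance at least \<open>r / 2\<close> from \<open>z\<close>, while
      \<open>F\<close> varies by at most \<open>2 * M\<close>.\<close>
    define K where "K = max (2 * N) (4 * M / r)"
    have K: "0 \<le> K" "2 * N \<le> K" "4 * M / r \<le> K" using c(3) by (auto simp: K_def)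
    have lip: "norm (F w - F z) \<le> K * norm (w - z)" if z: "z \<in> E \<inter> ball c (r/2)" and w: "w \<in> ball c r" for z w
    proof (rule Lipschitz_bound_off_slit[where E = "E \<inter> ball c r" and c = c and r = r])
      show "F holomorphic_on ball c r - E \<inter> ball c r"
        by (rule holomorphic_on_subset[OF holH]) (use ballW in \<open>auto simp: E_def\<close>)
      show "closedin (top_of_set (ball c r)) (E \<inter> ball c r)"
      proof -
        have "E \<inter> ball c r = ball c r \<inter> - H" using ballW by (auto simp: E_def)
        then show ?thesis using \<open>open H\<close> by (simp only: closedin_closed_Int closed_Compl)
      qed
      show "z \<in> E \<inter> ball c r" using z c(2) by auto
      then show "norm (F w - F z) \<le> K * norm (w - z)" if "w \<in> E \<inter> ball c r" for w
        using lipE[OF _ that, of z] mult_right_mono[OF K(2), of "norm (w - z)"] by simp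
      show "norm (F (z + of_real s) - F z) \<le> K * s" if "0 \<le> s" "z + of_real s \<in> ball c r" for s
      proof -
        have "norm (z + of_real s - z) \<le> 2 * r"
          using norm_triangle_ineq4[of "z + of_real s - c" "z - c"] that z c(2) by (auto simp: dist_norm norm_minus_commute)
        then have "norm (F (z + of_real s) - F z) \<le> N * s"
          using N[of z "z + of_real s"] z that c(2) by auto
        also have "\<dots> \<le> K * s" using K(2) c(3) that by (intro mult_right_mono) auto
        finally show ?thesis .
      qed
      show "norm (F w - F z) \<le> K * norm (w - z)" if "w \<in> sphere c r" for w
      proof -
        have "norm (F w - F z) \<le> 2 * M"
          using M[of w] M[of z] that z c(2) norm_triangle_ineq4[of "F w" "F z"] by auto
        also have "\<dots> = 4 * M / r * (r / 2)" using c(2) by simp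
        also have "\<dots> \<le> K * norm (w - z)"
        proof (rule mult_mono)
          show "r / 2 \<le> norm (w - z)"
            using that z dist_triangle[of c w z] by (auto simp: dist_norm norm_minus_commute)
        qed (use K c(2) in auto)
        finally show ?thesis .
      qed
    qed (use contc K w in auto)
    have DK: "norm (D w) \<le> 2 * K" if w: "w \<in> ball c (r/4)" for w
    proof (cases "w \<in> E")
      case True
      have "norm (D w) \<le> K"
      proof (rule norm_vector_derivative_le[OF dx, where \<delta> = "r/2"])
        show "w \<in> W" using True by (simp add: E_def)
        fix t :: real assume t: "\<bar>t\<bar> < r/2"
        have "w + of_real t \<in> ball c r"
          using w t c(2) norm_triangle_ineq[of "w - c" "of_real t"] by (auto simp: dist_norm norm_minus_commute algebra_simps)
        then show "norm (F (w + of_real t) - F (w + of_real 0)) \<le> K * \<bar>t\<bar>"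
          using lip[of w "w + of_real t"] True w c(2) by auto
      qed (use c(2) in auto)
      then show ?thesis using K by simp
    next
      case False
      define T where "T = E \<inter> cball c (r/2)"
      have "T = cball c (r/2) - H" using c(2,4) by (auto simp: T_def E_def)
      then have "closed T" using \<open>open H\<close> by (simp add: closed_Diff)
      moreover have cT: "c \<in> T" using c(1,2) by (auto simp: T_def)
      \<comment> \<open>A point of \<open>E\<close> closest to \<open>w\<close>: the open disc around \<open>w\<close> bounded by the circle through \<open>z\<close>
        is contained in \<open>H\<close>.\<close>
      ultimately obtain z where z: "z \<in> T" "\<And>u. u \<in> T \<Longrightarrow> dist w z \<le> dist w u"
        using distance_attains_inf[of T w] by auto
      define d where "d = dist w z"
      have "d < r / 4" using z(2)[OF cT] w by (auto simp: d_def dist_commute)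
      have "d > 0" using z(1) False by (auto simp: d_def T_def)
      have zE: "z \<in> E \<inter> ball c (r/2)"
        using z(1) dist_triangle[of c z w] w \<open>d < r/4\<close> by (auto simp: T_def d_def)
      have sub: "u \<in> ball c (r/2)" if "dist w u \<le> d" for u
        using that w \<open>d < r/4\<close> dist_triangle[of c u w] by auto
      have subH: "ball w d \<subseteq> H"
      proof
        fix u assume u: "u \<in> ball w d"
        then have "u \<in> cball c (r/2)" using sub[of u] by auto
        moreover have "u \<notin> T" using z(2)[of u] u by (auto simp: d_def)
        moreover have "u \<in> W" using calculation(1) c(2,4) by (force intro: subsetD[OF c(4)])
        ultimately show "u \<in> H" by (auto simp: T_def E_def)
      qed
      have holw: "F holomorphic_on ball w d" using holH subH by (rule holomorphic_on_subset)
      have "norm ((deriv ^^ 1) (\<lambda>u. F u - F z) w) \<le> fact 1 * (K * (2 * d)) / d ^ 1"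
      proof (rule Cauchy_inequality)
        show "(\<lambda>u. F u - F z) holomorphic_on ball w d" using holw by (intro holomorphic_intros)
        show "continuous_on (cball w d) (\<lambda>u. F u - F z)"
          using contc sub c(2) by (intro continuous_intros) (force intro: continuous_on_subset)
        fix u assume u: "norm (w - u) = d"
        then have "u \<in> ball c (r/2)" using sub[of u] by (auto simp: dist_norm)
        then have "norm (F u - F z) \<le> K * norm (u - z)" using lip[OF zE, of u] c(2) by auto
        also have "norm (u - z) \<le> 2 * d"
          using u dist_triangle[of u z w] by (auto simp: d_def dist_norm norm_minus_commute)
        finally show "norm (F u - F z) \<le> K * (2 * d)" using K by (simp add: mult_left_mono)
      qed fact
      moreover have dF: "(F has_field_derivative deriv F w) (at w)"
        using holomorphic_derivI[OF holw] \<open>d > 0\<close> by auto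
      moreover have "deriv (\<lambda>u. F u - F z) w = deriv F w"
        using dF by (intro DERIV_imp_deriv) (auto intro!: derivative_eq_intros)
      ultimately have "norm (deriv F w) \<le> 2 * K" using \<open>d > 0\<close> by simp
      moreover have "((\<lambda>s. F (w + of_real s)) has_vector_derivative deriv F w) (at 0)"
      proof -
        have "((\<lambda>s. w + of_real s) has_vector_derivative 1) (at 0)"
          by (auto intro!: derivative_eq_intros)
        from field_vector_diff_chain_at[OF this, of F "deriv F w"] show ?thesis
          using dF by (simp add: o_def)
      qed
      moreover have "w \<in> W" using w c(2) ballW by auto
      ultimately show ?thesis
        using vector_derivative_unique_at[OF dx, of w "deriv F w"] by auto
    qed
    \<comment> \<open>A rectangle around \<open>c\<close> inside the ball of radius \<open>r / 4\<close>, where the derivatives are bounded.\<close>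
    define h where "h = Complex (r/10) (r/10)"
    have box: "cbox (c - h) (c + h) \<subseteq> ball c (r/4)"
    proof
      fix w assume "w \<in> cbox (c - h) (c + h)"
      then have "\<bar>Re (w - c)\<bar> \<le> r/10" "\<bar>Im (w - c)\<bar> \<le> r/10"
        by (auto simp: in_cbox_complex_iff h_def abs_if)
      then have "norm (w - c) < r/4" using cmod_le[of "w - c"] c(2) by linarith
      then show "w \<in> ball c (r/4)" by (auto simp: dist_norm norm_minus_commute)
    qed
    have boxW: "cbox (c - h) (c + h) \<subseteq> W" using box ballW c(2) by force
    have "F holomorphic_on box (c - h) (c + h)"
      using boxW box dx dy DK
      by (intro Cauchy_Riemann_bounded_imp_holomorphic[where D = D and K = "2 * K"] continuous_on_subset[OF cont]) auto
    then have "box (c - h) (c + h) \<subseteq> H"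
      unfolding H_def using boxW box_subset_cbox[of "c - h" "c + h"] by (intro Union_upper) auto
    moreover have "c \<in> box (c - h) (c + h)"
      using c(2) by (auto simp: in_box_complex_iff h_def)
    ultimately show False using c(1) by (auto simp: E_def)
  qed
  then have "H = W" using \<open>H \<subseteq> W\<close> by (auto simp: E_def)
  with holH show ?thesis by simp
qed

section \<open>Riemann--Stieltjes sums over the unit interval\<close>

definition stieltjes_sum ::
  "(real \<Rightarrow> complex) \<Rightarrow> (real \<Rightarrow> complex) \<Rightarrow> (real \<times> real set) set \<Rightarrow> complex" where
  "stieltjes_sum f g D = (\<Sum>(t, K)\<in>D. f t * (g (Sup K) - g (Inf K)))"

definition increment :: "(real \<Rightarrow> complex) \<Rightarrow> real set \<Rightarrow> complex" where
  "increment g K = (if K = {} then 0 else g (Sup K) - g (Inf K))"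

text \<open>The increment of \<open>g\<close> over \<open>{a..b} \<inter> L\<close> is the increment over \<open>L\<close> of \<open>g\<close> composed with the
retraction of the line onto \<open>{a..b}\<close>; for that function the sum over a division of \<open>{0..1}\<close>
telescopes.\<close>

lemma increment_eq_sum_overlaps:
  assumes P: "P tagged_division_of {0..1}" and K: "a \<le> b" "{a..b} \<subseteq> {0..1}"
  shows "g b - g a = (\<Sum>(s, L)\<in>P. increment g ({a..b} \<inter> L))"
proof -
  \<comment> \<open>\<open>max a (min b x)\<close> is the point of \<open>{a..b}\<close> nearest to \<open>x\<close>.\<close>
  define h where "h x = g (max a (min b x))" for x
  have "(\<Sum>(s, L)\<in>P. increment g ({a..b} \<inter> L)) = (\<Sum>(s, L)\<in>P. h (Sup L) - h (Inf L))"
  proof (intro sum.cong refl, clarify)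
    fix s L assume "(s, L) \<in> P"
    then obtain c d where L: "L = {c..d}" "s \<in> L"
      using tagged_division_ofD(2,4)[OF P] by (metis box_real(2))
    then have "c \<le> d" by auto
    show "increment g ({a..b} \<inter> L) = h (Sup L) - h (Inf L)"
    proof (cases "max a c \<le> min b d")
      case True
      then show ?thesis
        using K(1) \<open>c \<le> d\<close> L by (auto simp: increment_def h_def min_def max_def split: if_splits)
    next
      case False
      then have "max a (min b d) = max a (min b c)"
        using K(1) \<open>c \<le> d\<close> by (auto simp: min_def max_def split: if_splits)
      then show ?thesis
        using False \<open>c \<le> d\<close> L by (auto simp: increment_def h_def)
    qed
  qed
  also have "\<dots> = h 1 - h 0"
    by (rule additive_tagged_division_1[OF _ P]) simp
  also have "\<dots> = g b - g a"
  proof -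
    have "0 \<le> a" "b \<le> 1" using K by auto
    then have "max a (min b 1) = b" "max a (min b 0) = a" using K by auto
    then show ?thesis by (simp only: h_def)
  qed
  finally show ?thesis by simp
qed

lemma sum_overlaps_le_variation:
  assumes D: "D tagged_division_of {0..1}" and P: "P tagged_division_of {0..1}"
    and B: "\<And>d. d division_of {0..1} \<Longrightarrow> (\<Sum>K\<in>d. norm (g (Sup K) - g (Inf K))) \<le> B"
  shows "(\<Sum>(t, K)\<in>D. \<Sum>(s, L)\<in>P. norm (increment g (K \<inter> L))) \<le> B"
proof -
  \<comment> \<open>The nonempty overlaps form a division of \<open>{0..1}\<close>. Different pairs may have the same overlap,
    but only a single point, where the increment is 0.\<close>
  define A where "A = {x \<in> D \<times> P. snd (fst x) \<inter> snd (snd x) \<noteq> {}}"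
  have fin: "finite D" "finite P" using D P by auto
  have "(\<Sum>(t, K)\<in>D. \<Sum>(s, L)\<in>P. norm (increment g (K \<inter> L)))
      = (\<Sum>x\<in>D \<times> P. norm (increment g (snd (fst x) \<inter> snd (snd x))))"
    by (simp add: sum.cartesian_product case_prod_unfold)
  also have "\<dots> = (\<Sum>x\<in>A. norm (increment g (snd (fst x) \<inter> snd (snd x))))"
    unfolding A_def by (rule sum.mono_neutral_right) (use fin in \<open>auto simp: increment_def\<close>)
  also have "\<dots> = (\<Sum>X\<in>(\<lambda>x. snd (fst x) \<inter> snd (snd x)) ` A. norm (increment g X))"
  proof (rule sum.reindex_nontrivial[symmetric, unfolded o_def])
    show "finite A" using fin by (auto simp: A_def)
    fix x y assume x: "x \<in> A" and y: "y \<in> A" and "x \<noteq> y"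
      and eq: "snd (fst x) \<inter> snd (snd x) = snd (fst y) \<inter> snd (snd y)"
    obtain t K s L where xx: "x = ((t, K), (s, L))" "(t, K) \<in> D" "(s, L) \<in> P"
      using x by (auto simp: A_def)
    obtain t' K' s' L' where yy: "y = ((t', K'), (s', L'))" "(t', K') \<in> D" "(s', L') \<in> P"
      using y by (auto simp: A_def)
    have "interior K \<inter> interior K' = {} \<or> interior L \<inter> interior L' = {}"
      using tagged_division_ofD(5)[OF D xx(2) yy(2)] tagged_division_ofD(5)[OF P xx(3) yy(3)] \<open>x \<noteq> y\<close>
      by (auto simp: xx yy)
    moreover have "K \<inter> L \<subseteq> K \<inter> K'" "K \<inter> L \<subseteq> L \<inter> L'"
      using eq by (auto simp: xx yy)
    then have "interior (K \<inter> L) \<subseteq> interior K \<inter> interior K'"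
      "interior (K \<inter> L) \<subseteq> interior L \<inter> interior L'"
      by (metis interior_Int interior_mono)+
    ultimately have int: "interior (K \<inter> L) = {}" by auto
    obtain a b c d where KL: "K = {a..b}" "L = {c..d}"
      using tagged_division_ofD(4)[OF D xx(2)] tagged_division_ofD(4)[OF P xx(3)] by (metis box_real(2))
    define u v where "u = max a c" and "v = min b d"
    have Kuv: "K \<inter> L = {u..v}" using KL by (auto simp: u_def v_def)
    moreover have "K \<inter> L \<noteq> {}" using x by (simp add: A_def xx)
    ultimately have "u = v" using int by simp
    then have "increment g (K \<inter> L) = 0"
      unfolding Kuv by (simp add: increment_def)
    then show "norm (increment g (snd (fst x) \<inter> snd (snd x))) = 0"
      by (simp add: xx)
  qed
  also have "\<dots> = (\<Sum>X\<in>(\<lambda>x. snd (fst x) \<inter> snd (snd x)) ` A. norm (g (Sup X) - g (Inf X)))"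
    by (intro sum.cong refl) (auto simp: increment_def A_def)
  also have "\<dots> \<le> B"
  proof (rule B)
    have "{k1 \<inter> k2 |k1 k2. k1 \<in> snd ` D \<and> k2 \<in> snd ` P \<and> k1 \<inter> k2 \<noteq> {}} division_of {0..1} \<inter> {0..1}"
      by (intro division_inter division_of_tagged_division D P)
    moreover have "{k1 \<inter> k2 |k1 k2. k1 \<in> snd ` D \<and> k2 \<in> snd ` P \<and> k1 \<inter> k2 \<noteq> {}}
        = (\<lambda>x. snd (fst x) \<inter> snd (snd x)) ` A"
    proof (intro equalityI subsetI)
      fix X assume "X \<in> {k1 \<inter> k2 |k1 k2. k1 \<in> snd ` D \<and> k2 \<in> snd ` P \<and> k1 \<inter> k2 \<noteq> {}}"
      then obtain k1 k2 where "X = k1 \<inter> k2" "k1 \<in> snd ` D" "k2 \<in> snd ` P" "k1 \<inter> k2 \<noteq> {}"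
        by blast
      moreover from this obtain t s where "(t, k1) \<in> D" "(s, k2) \<in> P"
        by auto
      ultimately have "X = k1 \<inter> k2" "(t, k1) \<in> D" "(s, k2) \<in> P" "k1 \<inter> k2 \<noteq> {}"
        by blast+
      then show "X \<in> (\<lambda>x. snd (fst x) \<inter> snd (snd x)) ` A"
        by (intro image_eqI[of _ _ "((t, k1), (s, k2))"]) (simp_all add: A_def)
    next
      fix X assume "X \<in> (\<lambda>x. snd (fst x) \<inter> snd (snd x)) ` A"
      then obtain x where x: "x \<in> A" "X = snd (fst x) \<inter> snd (snd x)" by blast
      then have "snd (fst x) \<in> snd ` D" "snd (snd x) \<in> snd ` P" "X \<noteq> {}"
        by (auto simp: A_def)
      with x(2) show "X \<in> {k1 \<inter> k2 |k1 k2. k1 \<in> snd ` D \<and> k2 \<in> snd ` P \<and> k1 \<inter> k2 \<noteq> {}}"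
        by blast
    qed
    ultimately show "(\<lambda>x. snd (fst x) \<inter> snd (snd x)) ` A division_of {0..1}" by simp
  qed
  finally show ?thesis .
qed

text \<open>Both sums can be written over the pairs of overlapping intervals of the two divisions, where they
use the same increments of \<open>g\<close> and tags at distance less than \<open>2 * \<delta>\<close>.\<close>

lemma stieltjes_sum_close:
  assumes D: "D tagged_division_of {0..1}" "\<And>t K. (t, K) \<in> D \<Longrightarrow> diameter K < \<delta>"
    and P: "P tagged_division_of {0..1}" "\<And>t K. (t, K) \<in> P \<Longrightarrow> diameter K < \<delta>"
    and B: "\<And>d. d division_of {0..1} \<Longrightarrow> (\<Sum>K\<in>d. norm (g (Sup K) - g (Inf K))) \<le> B"
    and osc: "\<And>s t. s \<in> {0..1} \<Longrightarrow> t \<in> {0..1} \<Longrightarrow> \<bar>s - t\<bar> < 2 * \<delta> \<Longrightarrow> norm (f s - f t) \<le> \<omega>"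
    and "\<omega> \<ge> 0"
  shows "norm (stieltjes_sum f g D - stieltjes_sum f g P) \<le> \<omega> * B"
proof -
  have expand: "stieltjes_sum f g Q = (\<Sum>(t, K)\<in>Q. \<Sum>(s, L)\<in>R. f t * increment g (K \<inter> L))"
    if Q: "Q tagged_division_of {0..1}" and R: "R tagged_division_of {0..1}" for Q R
    unfolding stieltjes_sum_def
  proof (intro sum.cong refl, clarify)
    fix t K assume tK: "(t, K) \<in> Q"
    then obtain a b where K: "K = {a..b}" "t \<in> K" "K \<subseteq> {0..1}"
      using tagged_division_ofD(2-4)[OF Q] by (metis box_real(2))
    then have "a \<le> b" by auto
    then have "g (Sup K) - g (Inf K) = (\<Sum>(s, L)\<in>R. increment g (K \<inter> L))"
      using increment_eq_sum_overlaps[OF R, of a b g] K by simp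
    then show "f t * (g (Sup K) - g (Inf K)) = (\<Sum>(s, L)\<in>R. f t * increment g (K \<inter> L))"
      by (simp add: sum_distrib_left case_prod_unfold)
  qed
  have "stieltjes_sum f g P = (\<Sum>(t, K)\<in>D. \<Sum>(s, L)\<in>P. f s * increment g (K \<inter> L))"
    unfolding expand[OF P(1) D(1)] case_prod_unfold by (subst sum.swap) (simp add: Int_commute)
  then have "stieltjes_sum f g D - stieltjes_sum f g P
      = (\<Sum>(t, K)\<in>D. \<Sum>(s, L)\<in>P. (f t - f s) * increment g (K \<inter> L))"
    unfolding expand[OF D(1) P(1)] by (simp add: sum_subtractf case_prod_unfold left_diff_distrib)
  also have "norm \<dots> \<le> (\<Sum>(t, K)\<in>D. \<Sum>(s, L)\<in>P. \<omega> * norm (increment g (K \<inter> L)))"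
    unfolding case_prod_unfold
  proof (intro order_trans[OF norm_sum] sum_mono)
    fix x y assume "x \<in> D" "y \<in> P"
    then obtain t K s L where xy: "x = (t, K)" "y = (s, L)" "(t, K) \<in> D" "(s, L) \<in> P"
      by (metis surj_pair)
    show "norm ((f (fst x) - f (fst y)) * increment g (snd x \<inter> snd y))
        \<le> \<omega> * norm (increment g (snd x \<inter> snd y))"
    proof (cases "K \<inter> L = {}")
      case True
      then show ?thesis by (simp add: xy increment_def)
    next
      case False
      then obtain z where z: "z \<in> K" "z \<in> L" by auto
      have tK: "t \<in> K" "K \<subseteq> {0..1}" and sL: "s \<in> L" "L \<subseteq> {0..1}"
        using tagged_division_ofD(2,3)[OF D(1) xy(3)] tagged_division_ofD(2,3)[OF P(1) xy(4)] by auto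
      have "bounded K" "bounded L" using tK sL bounded_subset[of "{0..1::real}"] by auto
      then have "dist t z \<le> diameter K" "dist s z \<le> diameter L"
        using z tK sL by (auto intro: diameter_bounded_bound)
      then have "\<bar>t - s\<bar> < 2 * \<delta>"
        using D(2)[OF xy(3)] P(2)[OF xy(4)] by (auto simp: dist_real_def)
      then have "norm (f t - f s) \<le> \<omega>" using tK sL by (intro osc) auto
      then show ?thesis by (simp add: xy norm_mult mult_right_mono)
    qed
  qed
  also have "\<dots> = \<omega> * (\<Sum>(t, K)\<in>D. \<Sum>(s, L)\<in>P. norm (increment g (K \<inter> L)))"
    by (simp add: sum_distrib_left case_prod_unfold)
  also have "\<dots> \<le> \<omega> * B"
    by (intro mult_left_mono sum_overlaps_le_variation D P B \<open>\<omega> \<ge> 0\<close>)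
  finally show ?thesis .
qed

definition uniform_division :: "nat \<Rightarrow> (real \<times> real set) set" where
  "uniform_division n = (\<lambda>k. (k / n, {k / n..Suc k / n})) ` {..<n}"

definition left_sum :: "(real \<Rightarrow> complex) \<Rightarrow> (real \<Rightarrow> complex) \<Rightarrow> nat \<Rightarrow> complex" where
  "left_sum f g n = (\<Sum>k<n. f (k / n) * (g (Suc k / n) - g (k / n)))"

lemma uniform_division_tagged:
  assumes "n > 0"
  shows "uniform_division n tagged_division_of {0..1}"
proof (rule tagged_division_ofI)
  show "finite (uniform_division n)" by (simp add: uniform_division_def)
  fix x K assume "(x, K) \<in> uniform_division n"
  then obtain k where k: "k < n" "x = k / n" "K = {k / n..Suc k / n}"
    by (auto simp: uniform_division_def)
  show "x \<in> K" "\<exists>a b. K = cbox a b" using k assms by (auto simp: divide_right_mono)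
  have "Suc k / n \<le> 1" using k assms by simp
  then show "K \<subseteq> {0..1}" using k by (auto intro: order_trans)
  fix y L assume "(y, L) \<in> uniform_division n"
  then obtain l where l: "l < n" "y = l / n" "L = {l / n..Suc l / n}"
    by (auto simp: uniform_division_def)
  assume "(x, K) \<noteq> (y, L)"
  then have "k < l \<or> l < k" using k l by auto
  then have "Suc k / n \<le> l / n \<or> Suc l / n \<le> k / n"
    by (auto simp del: of_nat_Suc intro!: divide_right_mono)
  then show "interior K \<inter> interior L = {}"
    unfolding k l by (auto simp del: of_nat_Suc)
next
  show "\<Union>{K. \<exists>x. (x, K) \<in> uniform_division n} = {0..1}"
  proof (intro equalityI subsetI)
    fix t assume "t \<in> \<Union>{K. \<exists>x. (x, K) \<in> uniform_division n}"
    then obtain k where k: "k < n" "k / n \<le> t" "t \<le> Suc k / n"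
      by (auto simp: uniform_division_def)
    moreover have "Suc k / n \<le> 1" "0 \<le> k / n" using k assms by simp_all
    ultimately show "t \<in> {0..1}" unfolding atLeastAtMost_iff by linarith
  next
    fix t :: real assume t: "t \<in> {0..1}"
    have "\<exists>k<n. k / n \<le> t \<and> t \<le> Suc k / n"
    proof (cases "t = 1")
      case True
      then show ?thesis using assms by (intro exI[of _ "n - 1"]) auto
    next
      case False
      define k where "k = nat \<lfloor>t * n\<rfloor>"
      have "0 \<le> t * n" using t by simp
      then have k: "real k \<le> t * n" "t * n < real k + 1"
        unfolding k_def by linarith+
      have "t * n < n" using t False assms by simp
      then have "k < n" using k by linarith
      then show ?thesis
        using k assms by (intro exI[of _ k]) (auto simp: field_simps)
    qed
    then obtain k where k: "k < n" "t \<in> {k / n..Suc k / n}" by auto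
    then have "(k / n, {k / n..Suc k / n}) \<in> uniform_division n"
      unfolding uniform_division_def using k(1) by (intro image_eqI[of _ _ k]) auto
    then show "t \<in> \<Union>{K. \<exists>x. (x, K) \<in> uniform_division n}"
      using k(2) by blast
  qed
qed

lemma uniform_division_diameter:
  assumes "(t, K) \<in> uniform_division n"
  shows "diameter K = 1 / n"
  using assms by (auto simp: uniform_division_def diameter_closed_interval divide_right_mono field_simps)

lemma stieltjes_sum_uniform:
  "stieltjes_sum f g (uniform_division n) = left_sum f g n"
proof -
  have inj: "inj_on (\<lambda>k. (k / n, {k / n..Suc k / n})) {..<n}"
    by (auto simp: inj_on_def)
  have "Sup {k / n..Suc k / n} = Suc k / n" "Inf {k / n..Suc k / n} = k / n" for k :: nat
    by (auto simp: divide_right_mono)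
  then show ?thesis
    unfolding stieltjes_sum_def uniform_division_def left_sum_def
    by (subst sum.reindex[OF inj]) (simp del: of_nat_Suc)
qed

text \<open>By \<open>stieltjes_sum_close\<close> and the uniform continuity of \<open>f\<close>, the sums over any two fine divisions are
close; so the uniform divisions give a Cauchy sequence, and its limit attracts all sums over fine
divisions.\<close>

lemma stieltjes_sums_converge:
  assumes f: "continuous_on {0..1} f" and g: "rectifiable g"
  shows "\<exists>I. left_sum f g \<longlonglongrightarrow> I \<and>
    (\<forall>\<epsilon>>0. \<exists>\<delta>>0. \<forall>D. D tagged_division_of {0..1} \<and> (\<forall>(t, K)\<in>D. diameter K < \<delta>) \<longrightarrow>
       norm (stieltjes_sum f g D - I) < \<epsilon>)"
proof -
  obtain B where B: "\<And>d. d division_of {0..1} \<Longrightarrow> (\<Sum>K\<in>d. norm (g (Sup K) - g (Inf K))) \<le> B"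
    using g by (auto simp: rectifiable_def)
  have close: "\<exists>\<delta>>0. \<forall>D P. D tagged_division_of {0..1} \<longrightarrow> (\<forall>(t, K)\<in>D. diameter K < \<delta>) \<longrightarrow>
      P tagged_division_of {0..1} \<longrightarrow> (\<forall>(t, K)\<in>P. diameter K < \<delta>) \<longrightarrow>
      norm (stieltjes_sum f g D - stieltjes_sum f g P) < \<epsilon>" if "\<epsilon> > 0" for \<epsilon>
  proof -
    define \<omega> where "\<omega> = \<epsilon> / (\<bar>B\<bar> + 1)"
    have "\<omega> > 0" using that by (simp add: \<omega>_def)
    moreover have "uniformly_continuous_on {0..1} f"
      using f by (intro compact_uniformly_continuous) auto
    ultimately obtain d where d: "d > 0"
      "\<And>s t. s \<in> {0..1} \<Longrightarrow> t \<in> {0..1} \<Longrightarrow> dist s t < d \<Longrightarrow> dist (f s) (f t) < \<omega>"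
      unfolding uniformly_continuous_on_def by (metis dist_commute)
    have "\<omega> * B \<le> \<omega> * \<bar>B\<bar>" using \<open>\<omega> > 0\<close> by (intro mult_left_mono) auto
    also have "\<dots> < \<epsilon>" using that by (simp add: \<omega>_def field_simps)
    finally have "\<omega> * B < \<epsilon>" .
    have "norm (stieltjes_sum f g D - stieltjes_sum f g P) \<le> \<omega> * B"
      if "D tagged_division_of {0..1}" "\<forall>(t, K)\<in>D. diameter K < d/2"
         "P tagged_division_of {0..1}" "\<forall>(t, K)\<in>P. diameter K < d/2" for D P
      using that d \<open>\<omega> > 0\<close>
      by (intro stieltjes_sum_close[where \<delta> = "d/2"] B) (auto simp: dist_norm less_imp_le)
    then have "norm (stieltjes_sum f g D - stieltjes_sum f g P) < \<epsilon>"
      if "D tagged_division_of {0..1}" "\<forall>(t, K)\<in>D. diameter K < d/2"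
         "P tagged_division_of {0..1}" "\<forall>(t, K)\<in>P. diameter K < d/2" for D P
      using that \<open>\<omega> * B < \<epsilon>\<close> by (meson le_less_trans)
    moreover have "d/2 > 0" using \<open>d > 0\<close> by simp
    ultimately show ?thesis by blast
  qed
  have fine: "\<exists>N. \<forall>n\<ge>N. n > 0 \<and> (\<forall>(t, K)\<in>uniform_division n. diameter K < \<delta>)" if "\<delta> > 0" for \<delta>
  proof -
    obtain N :: nat where N: "N > 0" "1 / N < \<delta>"
      using \<open>\<delta> > 0\<close> nat_approx_posE by (metis zero_less_Suc)
    have "n > 0 \<and> (\<forall>(t, K)\<in>uniform_division n. diameter K < \<delta>)" if "n \<ge> N" for n
    proof -
      have "1 / n \<le> 1 / N" using that N by (simp add: frac_le)
      then have "1 / n < \<delta>" using N by linarith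
      then show ?thesis using that N by (auto simp: uniform_division_diameter)
    qed
    then show ?thesis by blast
  qed
  have "Cauchy (left_sum f g)"
  proof (rule metric_CauchyI)
    fix \<epsilon> :: real assume "\<epsilon> > 0"
    from close[OF this] obtain \<delta> where \<delta>: "\<delta> > 0"
      "\<And>D P. D tagged_division_of {0..1} \<Longrightarrow> (\<forall>(t, K)\<in>D. diameter K < \<delta>) \<Longrightarrow>
      P tagged_division_of {0..1} \<Longrightarrow> (\<forall>(t, K)\<in>P. diameter K < \<delta>) \<Longrightarrow>
      norm (stieltjes_sum f g D - stieltjes_sum f g P) < \<epsilon>" by blast
    from fine[OF \<delta>(1)] obtain N where "\<forall>n\<ge>N. n > 0 \<and> (\<forall>(t, K)\<in>uniform_division n. diameter K < \<delta>)" ..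
    then have "\<forall>m\<ge>N. \<forall>n\<ge>N. dist (left_sum f g m) (left_sum f g n) < \<epsilon>"
      unfolding dist_norm stieltjes_sum_uniform[symmetric]
      by (intro allI impI \<delta>(2) uniform_division_tagged) auto
    then show "\<exists>N. \<forall>m\<ge>N. \<forall>n\<ge>N. dist (left_sum f g m) (left_sum f g n) < \<epsilon>" ..
  qed
  then obtain I where I: "left_sum f g \<longlonglongrightarrow> I"
    using Cauchy_convergent convergent_def by blast
  show ?thesis
  proof (intro exI[of _ I] conjI allI impI)
    show "left_sum f g \<longlonglongrightarrow> I" by fact
    fix \<epsilon> :: real assume "\<epsilon> > 0"
    then have "\<epsilon> / 2 > 0" by simp
    from close[OF this] obtain \<delta> where \<delta>: "\<delta> > 0"
      "\<And>D P. D tagged_division_of {0..1} \<Longrightarrow> (\<forall>(t, K)\<in>D. diameter K < \<delta>) \<Longrightarrow>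
      P tagged_division_of {0..1} \<Longrightarrow> (\<forall>(t, K)\<in>P. diameter K < \<delta>) \<Longrightarrow>
      norm (stieltjes_sum f g D - stieltjes_sum f g P) < \<epsilon> / 2" by blast
    have "norm (stieltjes_sum f g D - I) < \<epsilon>"
      if D: "D tagged_division_of {0..1}" "\<forall>(t, K)\<in>D. diameter K < \<delta>" for D
    proof -
      have "(\<lambda>n. norm (stieltjes_sum f g D - left_sum f g n)) \<longlonglongrightarrow> norm (stieltjes_sum f g D - I)"
        by (intro tendsto_intros I)
      moreover from fine[OF \<delta>(1)] obtain N where
        N: "\<forall>n\<ge>N. n > 0 \<and> (\<forall>(t, K)\<in>uniform_division n. diameter K < \<delta>)" ..
      have "\<forall>n\<ge>N. norm (stieltjes_sum f g D - left_sum f g n) \<le> \<epsilon> / 2"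
        unfolding stieltjes_sum_uniform[symmetric]
        using N by (intro allI impI less_imp_le \<delta>(2) D uniform_division_tagged) auto
      ultimately have "norm (stieltjes_sum f g D - I) \<le> \<epsilon> / 2"
        by (intro LIMSEQ_le_const2) blast+
      then show ?thesis using \<open>\<epsilon> > 0\<close> by simp
    qed
    then show "\<exists>\<delta>>0. \<forall>D. D tagged_division_of {0..1} \<and> (\<forall>(t, K)\<in>D. diameter K < \<delta>) \<longrightarrow>
       norm (stieltjes_sum f g D - I) < \<epsilon>"
      using \<delta>(1) by blast
  qed
qed

section \<open>Line integrals over rectifiable curves\<close>

text \<open>If each of the \<open>n\<close> pieces of \<open>\<Gamma>\<close> stays in a convex subset of \<open>G\<close>, it can be deformed to its chord
there. Induction on the number \<open>m\<close> of pieces yields the homotopy and the value of the contour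
integral over the polygon at the same time.\<close>

lemma homotopic_to_polygon:
  fixes \<Gamma> :: "real \<Rightarrow> complex" and m n :: nat
  assumes "path \<Gamma>" "path_image \<Gamma> \<subseteq> G" "open G" and q: "q holomorphic_on G" and "n > 0"
    and near: "\<And>k t. k < n \<Longrightarrow> t \<in> {k / n..Suc k / n} \<Longrightarrow> \<Gamma> t \<in> U k"
    and U: "\<And>k. k < n \<Longrightarrow> convex (U k) \<and> U k \<subseteq> G"
    and "m \<le> n"
  shows "\<exists>g. valid_path g \<and> homotopic_paths G g (subpath 0 (m / n) \<Gamma>) \<and>
    contour_integral g q = (\<Sum>k<m. contour_integral (linepath (\<Gamma> (k / n)) (\<Gamma> (Suc k / n))) q)"
  using \<open>m \<le> n\<close>
proof (induction m)
  case 0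
  have "\<Gamma> 0 \<in> G" using assms(2) by (auto simp: path_image_def)
  then have "homotopic_paths G (linepath (\<Gamma> 0) (\<Gamma> 0)) (subpath 0 0 \<Gamma>)"
    by (simp add: subpath_def linepath_def homotopic_paths_refl path_def path_image_def image_subset_iff)
  moreover have "valid_path (linepath (\<Gamma> 0) (\<Gamma> 0))" by (rule valid_path_linepath)
  moreover have "contour_integral (linepath (\<Gamma> 0) (\<Gamma> 0)) q = 0" by (rule contour_integral_trivial)
  ultimately show ?case by auto
next
  case (Suc m)
  define a b where "a = m / n" and "b = Suc m / n"
  then have "a \<le> b" and ab: "a \<in> {0..1}" "b \<in> {0..1}"
    using Suc.prems \<open>n > 0\<close> by (auto simp: divide_right_mono)
  obtain g where g: "valid_path g" "homotopic_paths G g (subpath 0 a \<Gamma>)"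
    "contour_integral g q = (\<Sum>k<m. contour_integral (linepath (\<Gamma> (k / n)) (\<Gamma> (Suc k / n))) q)"
    using Suc a_def by auto
  let ?l = "linepath (\<Gamma> a) (\<Gamma> b)"
  have U': "convex (U m)" "U m \<subseteq> G" and inU: "\<And>t. t \<in> {a..b} \<Longrightarrow> \<Gamma> t \<in> U m"
    using U[of m] near[of m] Suc.prems by (auto simp: a_def b_def)
  have mem: "a + t * (b - a) \<in> {a..b}" if "t \<in> {0..1}" for t
    using that \<open>a \<le> b\<close> mult_right_mono[of t 1 "b - a"] by auto
  have "homotopic_paths G ?l (subpath a b \<Gamma>)"
  proof (rule homotopic_paths_linear)
    fix t :: real assume t: "t \<in> {0..1}"
    have "?l t \<in> closed_segment (\<Gamma> a) (\<Gamma> b)" using t by (metis linepath_in_path)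
    then have "?l t \<in> U m"
      using closed_segment_subset[OF inU[of a] inU[of b] U'(1)] \<open>a \<le> b\<close> by auto
    moreover have "subpath a b \<Gamma> t \<in> U m"
      using inU[OF mem[OF t]] by (simp add: subpath_def algebra_simps)
    ultimately show "closed_segment (?l t) (subpath a b \<Gamma> t) \<subseteq> G"
      using closed_segment_subset U' by blast
  qed (use \<open>path \<Gamma>\<close> ab in auto)
  with g(2) have "homotopic_paths G (g +++ ?l) (subpath 0 a \<Gamma> +++ subpath a b \<Gamma>)"
    by (intro homotopic_paths_join) (auto dest: homotopic_paths_imp_pathfinish)
  moreover have "homotopic_paths G (subpath 0 a \<Gamma> +++ subpath a b \<Gamma>) (subpath 0 b \<Gamma>)"
    using assms(1,2) ab by (intro homotopic_join_subpaths) auto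
  ultimately have hom: "homotopic_paths G (g +++ ?l) (subpath 0 b \<Gamma>)"
    by (rule homotopic_paths_trans)
  have fin: "pathfinish g = \<Gamma> a"
    using homotopic_paths_imp_pathfinish[OF g(2)] by simp
  have "path_image ?l \<subseteq> G" "path_image g \<subseteq> G"
    using closed_segment_subset[OF inU[of a] inU[of b] U'(1)] \<open>a \<le> b\<close> U'(2) homotopic_paths_imp_subset[OF g(2)]
    by auto
  then have "q contour_integrable_on ?l" "q contour_integrable_on g"
    using q \<open>open G\<close> g(1) by (auto intro!: contour_integrable_holomorphic_simple)
  then have "contour_integral (g +++ ?l) q = contour_integral g q + contour_integral ?l q"
    using g(1) by simp
  moreover have "valid_path (g +++ ?l)" using g(1) fin by (intro valid_path_join) auto
  ultimately show ?case
    using hom g(3) by (intro exI[of _ "g +++ ?l"]) (simp add: a_def b_def)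
qed

text \<open>The left sum is compared chord by chord with the contour integral over the inscribed polygon with \<open>n\<close>
edges: by uniform continuity of \<open>q\<close> near the curve the difference is at most a small multiple of the
length of \<open>\<Gamma>\<close>. For large \<open>n\<close> the polygon is homotopic to \<open>C\<close> in \<open>G\<close>, so its contour integral is
exactly that of \<open>C\<close>.\<close>

lemma left_sums_tendsto_contour_integral:
  fixes \<Gamma> :: "real \<Rightarrow> complex"
  assumes "path \<Gamma>" "rectifiable \<Gamma>" "open G" and q: "q holomorphic_on G"
    and hom: "homotopic_loops G \<Gamma> C" and C: "valid_path C"
  shows "left_sum (\<lambda>t. q (\<Gamma> t)) \<Gamma> \<longlonglongrightarrow> contour_integral C q"
proof (rule LIMSEQ_I)
  fix \<epsilon> :: real assume "\<epsilon> > 0"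
  obtain B where B: "\<And>d. d division_of {0..1} \<Longrightarrow> (\<Sum>K\<in>d. norm (\<Gamma> (Sup K) - \<Gamma> (Inf K))) \<le> B"
    using \<open>rectifiable \<Gamma>\<close> by (auto simp: rectifiable_def)
  have imG: "path_image \<Gamma> \<subseteq> G" and closed: "pathfinish \<Gamma> = pathstart \<Gamma>"
    using homotopic_loops_imp_subset[OF hom] homotopic_loops_imp_loop[OF hom] by auto
  define \<omega> where "\<omega> = \<epsilon> / (\<bar>B\<bar> + 1)"
  have "\<omega> > 0" using \<open>\<epsilon> > 0\<close> by (simp add: \<omega>_def)
  obtain e where e: "e > 0" "{x. infdist x (path_image \<Gamma>) \<le> e} \<subseteq> G"
    using compact_in_open_separated[OF path_image_nonempty compact_path_image[OF \<open>path \<Gamma>\<close>] \<open>open G\<close> imG] by blast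
  \<comment> \<open>A compact neighbourhood of the curve, which also contains the chords.\<close>
  define T where "T = {x. infdist x (path_image \<Gamma>) \<le> e}"
  have "compact T" unfolding T_def
    by (intro compact_infdist_le path_image_nonempty compact_path_image \<open>path \<Gamma>\<close> e)
  then have "uniformly_continuous_on T q"
    using e(2) q by (intro compact_uniformly_continuous)
      (auto simp: T_def intro: continuous_on_subset holomorphic_on_imp_continuous_on)
  then obtain d0 where d0: "d0 > 0" "\<And>x y. x \<in> T \<Longrightarrow> y \<in> T \<Longrightarrow> dist x y < d0 \<Longrightarrow> dist (q x) (q y) < \<omega>"
    unfolding uniformly_continuous_on_def using \<open>\<omega> > 0\<close> by (metis dist_commute)
  define d where "d = min e d0"
  have "d > 0" using e d0 by (simp add: d_def)
  have "uniformly_continuous_on {0..1} \<Gamma>"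
    using \<open>path \<Gamma>\<close> by (intro compact_uniformly_continuous) (auto simp: path_def)
  then obtain \<delta> where \<delta>: "\<delta> > 0"
    "\<And>s t. s \<in> {0..1} \<Longrightarrow> t \<in> {0..1} \<Longrightarrow> dist s t < \<delta> \<Longrightarrow> dist (\<Gamma> s) (\<Gamma> t) < d"
    unfolding uniformly_continuous_on_def using \<open>d > 0\<close> by (metis dist_commute)
  obtain N :: nat where N: "N > 0" "1 / N < \<delta>"
    using \<open>\<delta> > 0\<close> nat_approx_posE by (metis zero_less_Suc)
  have "norm (left_sum (\<lambda>t. q (\<Gamma> t)) \<Gamma> n - contour_integral C q) < \<epsilon>" if "n \<ge> N" for n
  proof -
    have "n > 0" using that N by simp
    have "1 / n \<le> 1 / N" using that N by (simp add: frac_le)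
    then have small: "1 / n < \<delta>" using N by linarith
    \<comment> \<open>The convex sets for \<open>homotopic_to_polygon\<close>: \<open>d \<le> e\<close> keeps them in \<open>G\<close>, and \<open>d \<le> d0\<close> makes the
      oscillation of \<open>q\<close> on them at most \<open>\<omega>\<close>.\<close>
    define U where "U k = ball (\<Gamma> (k / n)) d" for k :: nat
    have node: "k / n \<in> {0..1}" "Suc k / n \<in> {0..1}" if "k < n" for k
      using that by auto
    have UT: "U k \<subseteq> T" if "k < n" for k
    proof
      fix x assume "x \<in> U k"
      then have "dist x (\<Gamma> (k / n)) \<le> e" by (simp add: U_def d_def dist_commute)
      moreover have "\<Gamma> (k / n) \<in> path_image \<Gamma>" using node[OF that] by (auto simp: path_image_def)
      ultimately show "x \<in> T" unfolding T_def by (auto intro: infdist_le2)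
    qed
    have U: "convex (U k) \<and> U k \<subseteq> G" if "k < n" for k
      using UT[OF that] e(2) by (auto simp: U_def T_def)
    have near: "\<Gamma> t \<in> U k" if k: "k < n" "t \<in> {k / n..Suc k / n}" for k t
    proof -
      have "Suc k / n = k / n + 1 / n" by (simp add: add_divide_distrib)
      then have "\<bar>k / n - t\<bar> < \<delta>" using k(2) small by simp
      moreover have "t \<in> {0..1}" using node[OF k(1)] k(2) unfolding atLeastAtMost_iff by linarith
      ultimately show ?thesis
        using \<delta>(2)[OF node(1)[OF k(1)], of t] by (simp add: U_def dist_real_def)
    qed
    have "\<exists>g. valid_path g \<and> homotopic_paths G g (subpath 0 (n / n) \<Gamma>) \<and>
      contour_integral g q = (\<Sum>k<n. contour_integral (linepath (\<Gamma> (k / n)) (\<Gamma> (Suc k / n))) q)"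
      by (rule homotopic_to_polygon[where U = U])
         (fact \<open>path \<Gamma>\<close> imG \<open>open G\<close> q \<open>n > 0\<close> near U order_refl)+
    then obtain g where g: "valid_path g" "homotopic_paths G g (subpath 0 (n / n) \<Gamma>)"
      "contour_integral g q = (\<Sum>k<n. contour_integral (linepath (\<Gamma> (k / n)) (\<Gamma> (Suc k / n))) q)"
      by (elim exE conjE)
    have gh: "homotopic_paths G g \<Gamma>" using g(2) \<open>n > 0\<close> by simp
    then have "homotopic_loops G g \<Gamma>"
      using closed homotopic_paths_imp_pathstart[OF gh] homotopic_paths_imp_pathfinish[OF gh]
      by (intro homotopic_paths_imp_homotopic_loops) auto
    then have "homotopic_loops G g C" using hom homotopic_loops_trans by blast
    then have gC: "contour_integral g q = contour_integral C q"
      using \<open>open G\<close> q g(1) C by (rule Cauchy_theorem_homotopic_loops)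
    have piece: "norm (q (\<Gamma> (k / n)) * (\<Gamma> (Suc k / n) - \<Gamma> (k / n))
        - contour_integral (linepath (\<Gamma> (k / n)) (\<Gamma> (Suc k / n))) q)
        \<le> \<omega> * norm (\<Gamma> (Suc k / n) - \<Gamma> (k / n))" if "k < n" for k
    proof -
      let ?a = "\<Gamma> (k / n)" and ?b = "\<Gamma> (Suc k / n)"
      have seg: "closed_segment ?a ?b \<subseteq> U k"
        using U[OF that] near[OF that] by (intro closed_segment_subset) (auto simp: divide_right_mono)
      have "q contour_integrable_on linepath ?a ?b"
        using seg U[OF that] q \<open>open G\<close> by (intro contour_integrable_holomorphic_simple[of _ G]) auto
      then have int: "((\<lambda>z. q z - q ?a) has_contour_integral
          (contour_integral (linepath ?a ?b) q - q ?a * (?b - ?a))) (linepath ?a ?b)"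
        by (intro has_contour_integral_diff has_contour_integral_integral has_contour_integral_const_linepath)
      have "norm (q z - q ?a) \<le> \<omega>" if z: "z \<in> closed_segment ?a ?b" for z
      proof -
        have zU: "z \<in> U k" using seg z by blast
        have "?a \<in> U k" using seg by auto
        then have "dist (q z) (q ?a) < \<omega>"
          using zU UT[OF \<open>k < n\<close>] by (intro d0(2)) (auto simp: U_def d_def dist_commute)
        then show ?thesis by (simp add: dist_norm)
      qed
      from has_contour_integral_bound_linepath[OF int _ this] \<open>\<omega> > 0\<close>
      show ?thesis by (simp add: norm_minus_commute)
    qed
    have "left_sum (\<lambda>t. q (\<Gamma> t)) \<Gamma> n - contour_integral C q =
      (\<Sum>k<n. q (\<Gamma> (k / n)) * (\<Gamma> (Suc k / n) - \<Gamma> (k / n))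
        - contour_integral (linepath (\<Gamma> (k / n)) (\<Gamma> (Suc k / n))) q)"
      unfolding gC[symmetric] g(3) left_sum_def by (simp only: sum_subtractf)
    also have "norm \<dots> \<le> (\<Sum>k<n. \<omega> * norm (\<Gamma> (Suc k / n) - \<Gamma> (k / n)))"
      using piece by (intro order_trans[OF norm_sum] sum_mono) auto
    also have "\<dots> = \<omega> * (\<Sum>K\<in>snd ` uniform_division n. norm (\<Gamma> (Sup K) - \<Gamma> (Inf K)))"
    proof -
      have inj: "inj_on (\<lambda>k::nat. {k / n..Suc k / n}) {..<n}"
        using \<open>n > 0\<close> by (auto simp: inj_on_def Icc_eq_Icc divide_right_mono)
      have "Sup {k / n..Suc k / n} = Suc k / n" "Inf {k / n..Suc k / n} = k / n" for k :: nat
        by (auto simp: divide_right_mono)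
      then show ?thesis
        unfolding uniform_division_def image_image snd_conv
        by (subst sum.reindex[OF inj]) (simp add: sum_distrib_left del: of_nat_Suc)
    qed
    also have "\<dots> \<le> \<omega> * B"
      using \<open>\<omega> > 0\<close> by (intro mult_left_mono B division_of_tagged_division uniform_division_tagged \<open>n > 0\<close>) auto
    also have "\<dots> \<le> \<omega> * \<bar>B\<bar>" using \<open>\<omega> > 0\<close> by (intro mult_left_mono) auto
    also have "\<dots> < \<epsilon>" using \<open>\<epsilon> > 0\<close> by (simp add: \<omega>_def field_simps)
    finally show ?thesis .
  qed
  then show "\<exists>N. \<forall>n\<ge>N. norm (left_sum (\<lambda>t. q (\<Gamma> t)) \<Gamma> n - contour_integral C q) < \<epsilon>" by blast
qed

text \<open>The uniform divisions are eventually finer than any \<open>\<delta>\<close>, so every Riemann--Stieltjes integral is the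
limit of the left sums. This is the uniqueness that the definite description in \<open>line_integral\<close>
requires.\<close>

lemma line_integral_limit:
  assumes \<gamma>: "path \<gamma>" "rectifiable \<gamma>" and \<psi>: "continuous_on (path_image \<gamma>) \<psi>"
  shows "left_sum (\<lambda>t. \<psi> (\<gamma> t)) (\<lambda>t. of_real (\<gamma> t $ j)) \<longlonglongrightarrow> line_integral j \<gamma> \<psi>"
proof -
  let ?f = "\<lambda>t. \<psi> (\<gamma> t)" and ?g = "\<lambda>t. complex_of_real (\<gamma> t $ j)"
  have "continuous_on {0..1} ?f"
    using \<gamma>(1) by (intro continuous_on_compose2[OF \<psi>]) (auto simp: path_def path_image_def)
  moreover have "rectifiable ?g"
  proof -
    obtain B where B: "\<And>d. d division_of {0..1} \<Longrightarrow> (\<Sum>K\<in>d. norm (\<gamma> (Sup K) - \<gamma> (Inf K))) \<le> B"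
      using \<gamma>(2) by (auto simp: rectifiable_def)
    have "norm (?g s - ?g t) \<le> norm (\<gamma> s - \<gamma> t)" for s t
      using component_le_norm_cart[of "\<gamma> s - \<gamma> t" j] by (simp flip: of_real_diff)
    then have "(\<Sum>K\<in>d. norm (?g (Sup K) - ?g (Inf K))) \<le> B" if "d division_of {0..1}" for d
      by (intro order_trans[OF sum_mono B[OF that]])
    then show ?thesis unfolding rectifiable_def by blast
  qed
  ultimately have "\<exists>I. left_sum ?f ?g \<longlonglongrightarrow> I \<and>
    (\<forall>\<epsilon>>0. \<exists>\<delta>>0. \<forall>D. D tagged_division_of {0..1} \<and> (\<forall>(t, K)\<in>D. diameter K < \<delta>) \<longrightarrow>
       norm (stieltjes_sum ?f ?g D - I) < \<epsilon>)"
    by (rule stieltjes_sums_converge)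
  then obtain I where I: "left_sum ?f ?g \<longlonglongrightarrow> I"
    "\<forall>\<epsilon>>0. \<exists>\<delta>>0. \<forall>D. D tagged_division_of {0..1} \<and> (\<forall>(t, K)\<in>D. diameter K < \<delta>) \<longrightarrow>
       norm (stieltjes_sum ?f ?g D - I) < \<epsilon>"
    by (elim exE conjE)
  have sums: "(\<Sum>(t, K)\<in>D. ?f t * of_real (\<gamma> (Sup K) $ j - \<gamma> (Inf K) $ j)) = stieltjes_sum ?f ?g D" for D
    by (simp add: stieltjes_sum_def)
  have RS: "has_RS_integral ?f (\<lambda>t. \<gamma> t $ j) I"
    unfolding has_RS_integral_def sums by (fact I(2))
  have "J = I" if J: "has_RS_integral ?f (\<lambda>t. \<gamma> t $ j) J" for J
  proof (rule LIMSEQ_unique[OF _ I(1)], rule LIMSEQ_I)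
    fix \<epsilon> :: real assume "\<epsilon> > 0"
    from J[unfolded has_RS_integral_def sums, THEN spec, THEN mp, OF this]
    obtain \<delta> where \<delta>: "\<delta> > 0"
      "\<forall>D. D tagged_division_of {0..1} \<and> (\<forall>(t, K)\<in>D. diameter K < \<delta>) \<longrightarrow>
         norm (stieltjes_sum ?f ?g D - J) < \<epsilon>"
      by (elim exE conjE)
    obtain N :: nat where N: "N > 0" "1 / N < \<delta>"
      using \<open>\<delta> > 0\<close> nat_approx_posE by (metis zero_less_Suc)
    have "norm (left_sum ?f ?g n - J) < \<epsilon>" if "n \<ge> N" for n
    proof -
      have "1 / n \<le> 1 / N" using that N by (simp add: frac_le)
      then have "1 / n < \<delta>" using N by linarith
      then show ?thesis unfolding stieltjes_sum_uniform[symmetric]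
        using that N
        by (intro \<delta>(2)[THEN spec, THEN mp] conjI uniform_division_tagged)
           (auto simp: uniform_division_diameter)
    qed
    then show "\<exists>N. \<forall>n\<ge>N. norm (left_sum ?f ?g n - J) < \<epsilon>" by blast
  qed
  with RS have "line_integral j \<gamma> \<psi> = I"
    unfolding line_integral_def by (intro the_equality)
  with I(1) show ?thesis by simp
qed

section \<open>Functions that factor through a linear map to the plane\<close>

text \<open>The left-hand limit in the direction \<open>h\<close> is the right-hand limit in the direction \<open>- h\<close>, and the two
agree because the derivative is linear in the direction.\<close>

lemma has_vector_derivative_from_one_sided:
  fixes U :: "'a::real_vector \<Rightarrow> complex"
  assumes f: "linear f"
    and der: "\<And>h. ((\<lambda>\<epsilon>::real. (U (p + \<epsilon> *\<^sub>R h) - U p) /\<^sub>R \<epsilon>) \<longlongrightarrow> f h * d) (at_right 0)"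
  shows "((\<lambda>s. U (p + s *\<^sub>R h)) has_vector_derivative f h * d) (at 0)"
proof -
  have "((\<lambda>\<epsilon>. - ((U (p + \<epsilon> *\<^sub>R (- h)) - U p) /\<^sub>R \<epsilon>)) \<longlongrightarrow> - (f (- h) * d)) (at_right 0)"
    by (intro tendsto_minus der)
  then have "((\<lambda>\<epsilon>. (U (p + \<epsilon> *\<^sub>R h) - U p) /\<^sub>R \<epsilon>) \<longlongrightarrow> f h * d) (at_left 0)"
    by (simp add: filterlim_at_left_to_right linear_neg[OF f])
  with der show ?thesis
    unfolding has_vector_derivative_iff_quotient by (simp add: filterlim_split_at)
qed

text \<open>On a segment in a fibre of \<open>f\<close> the derivative of \<open>U\<close> is \<open>f (q - p) * d = 0\<close>, so \<open>U\<close> descends to a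
function \<open>F\<close> on \<open>f ` \<Omega>\<close>. A linear right inverse \<open>g\<close> of \<open>f\<close> gives \<open>F (f p + z) = U (p + g z)\<close> for small
\<open>z\<close>; so \<open>F\<close> inherits continuity and, since \<open>f (g u) = u\<close>, has the directional derivatives
\<open>u * d\<close>, which for \<open>u = 1\<close> and \<open>u = \<i>\<close> are the Cauchy--Riemann equations.\<close>

lemma factors_through_linear_map:
  fixes f :: "'a::euclidean_space \<Rightarrow> complex" and U :: "'a \<Rightarrow> complex"
  assumes f: "linear f" "surj f" and "open \<Omega>"
    and conv: "\<And>p q. p \<in> \<Omega> \<Longrightarrow> q \<in> \<Omega> \<Longrightarrow> f p = f q \<Longrightarrow> closed_segment p q \<subseteq> \<Omega>"
    and cont: "continuous_on \<Omega> U"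
    and der: "\<And>p. p \<in> \<Omega> \<Longrightarrow> \<exists>d. \<forall>h.
       ((\<lambda>\<epsilon>::real. (U (p + \<epsilon> *\<^sub>R h) - U p) /\<^sub>R \<epsilon>) \<longlongrightarrow> f h * d) (at_right 0)"
  obtains F where "F holomorphic_on f ` \<Omega>" "\<And>p. p \<in> \<Omega> \<Longrightarrow> F (f p) = U p"
proof -
  have "\<exists>d. \<forall>h. ((\<lambda>s. U (p + s *\<^sub>R h)) has_vector_derivative f h * d) (at 0)" if "p \<in> \<Omega>" for p
    using der[OF that] has_vector_derivative_from_one_sided[OF f(1)] by blast
  then obtain d where d: "\<And>p h. p \<in> \<Omega> \<Longrightarrow> ((\<lambda>s. U (p + s *\<^sub>R h)) has_vector_derivative f h * d p) (at 0)"
    by metis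
  have fibre: "U p = U q" if pq: "p \<in> \<Omega>" "q \<in> \<Omega>" "f p = f q" for p q
  proof -
    define \<phi> where "\<phi> s = U (p + s *\<^sub>R (q - p))" for s :: real
    have "(\<phi> has_vector_derivative 0) (at t within {0..1})" if t: "t \<in> {0..1}" for t
    proof -
      have "p + t *\<^sub>R (q - p) \<in> closed_segment p q"
        using t unfolding closed_segment_def by (auto simp: algebra_simps intro!: exI[of _ t])
      then have "p + t *\<^sub>R (q - p) \<in> \<Omega>" using conv[OF pq] by blast
      from d[OF this, of "q - p"]
      have "((\<lambda>s. \<phi> (t + s)) has_vector_derivative 0) (at 0)"
        using pq(3) by (simp add: \<phi>_def linear_diff[OF f(1)] algebra_simps)
      then have "((\<lambda>s. \<phi> (t + s)) \<circ> (\<lambda>s. s - t) has_vector_derivative 1 *\<^sub>R 0) (at t)"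
        by (intro vector_diff_chain_at) (auto intro!: derivative_eq_intros)
      then show ?thesis by (auto simp: o_def intro: has_vector_derivative_at_within)
    qed
    then obtain c where "\<And>t. t \<in> {0..1} \<Longrightarrow> \<phi> t = c"
      using has_vector_derivative_zero_constant[of "{0..1::real}" \<phi>] by auto
    then have "\<phi> 0 = \<phi> 1" by simp
    then show ?thesis by (simp add: \<phi>_def)
  qed
  define F where "F w = U (SOME p. p \<in> \<Omega> \<and> f p = w)" for w
  have F: "F (f p) = U p" if "p \<in> \<Omega>" for p
  proof -
    have "(SOME q. q \<in> \<Omega> \<and> f q = f p) \<in> \<Omega> \<and> f (SOME q. q \<in> \<Omega> \<and> f q = f p) = f p"
      by (rule someI[of _ p]) (use that in auto)
    then show ?thesis unfolding F_def using fibre that by blast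
  qed
  obtain g where g: "linear g" "f \<circ> g = id"
    using linear_surjective_right_inverse[OF f] by blast
  then have fg: "f (g w) = w" for w by (metis comp_apply id_apply)
  have contg: "continuous_on UNIV g" using g(1) by (simp add: linear_continuous_on linear_conv_bounded_linear)
  have "open (f ` \<Omega>)" using \<open>open \<Omega>\<close> f by (rule open_surjective_linear_image)
  have F': "F (f p + z) = U (p + g z)" if "p + g z \<in> \<Omega>" for p z
    using F[OF that] by (simp add: linear_add[OF f(1)] fg)
  have open': "open ((\<lambda>z. p + g z) -` \<Omega>)" for p
    using contg \<open>open \<Omega>\<close> by (intro open_vimage continuous_intros)
  have "continuous_on (f ` \<Omega>) F"
    unfolding continuous_on_eq_continuous_at[OF \<open>open (f ` \<Omega>)\<close>]
  proof clarify
    fix p assume p: "p \<in> \<Omega>"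
    have "isCont (\<lambda>z. U (p + g z)) 0"
    proof -
      have "continuous_on ((\<lambda>z. p + g z) -` \<Omega>) (\<lambda>z. U (p + g z))"
        by (rule continuous_on_compose2[OF cont])
           (auto intro!: continuous_intros continuous_on_subset[OF contg])
      then show ?thesis
        using p open'[of p] by (simp add: continuous_on_eq_continuous_at linear_0[OF g(1)])
    qed
    then have "(\<lambda>z. U (p + g z)) \<midarrow>0\<rightarrow> U p" by (simp add: isCont_def linear_0[OF g(1)])
    moreover have "\<forall>\<^sub>F z in at 0. U (p + g z) = F (f p + z)"
      unfolding eventually_at_topological
      using open'[of p] p F' by (intro exI[of _ "(\<lambda>z. p + g z) -` \<Omega>"]) (auto simp: linear_0[OF g(1)])
    ultimately have "(\<lambda>z. F (f p + z)) \<midarrow>0\<rightarrow> U p" by (rule Lim_transform_eventually)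
    then show "isCont F (f p)" using F[OF p] by (simp add: isCont_iff)
  qed
  moreover obtain D where D: "\<And>w. w \<in> f ` \<Omega> \<Longrightarrow> \<forall>u. ((\<lambda>s. F (w + s *\<^sub>R u)) has_vector_derivative u * D w) (at 0)"
  proof -
    have "((\<lambda>s. F (f p + s *\<^sub>R u)) has_vector_derivative u * d p) (at 0)" if p: "p \<in> \<Omega>" for p u
    proof (rule has_vector_derivative_transform_within_open)
      show "((\<lambda>s. U (p + s *\<^sub>R g u)) has_vector_derivative u * d p) (at 0)"
        using d[OF p, of "g u"] by (simp add: fg)
      show "open ((\<lambda>s::real. p + s *\<^sub>R g u) -` \<Omega>)"
        using \<open>open \<Omega>\<close> by (intro open_vimage continuous_intros)
      show "U (p + s *\<^sub>R g u) = F (f p + s *\<^sub>R u)" if "s \<in> (\<lambda>s. p + s *\<^sub>R g u) -` \<Omega>" for s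
        using F'[of p "s *\<^sub>R u"] that by (simp add: linear_scale[OF g(1)])
    qed (use p in auto)
    then have "\<forall>w\<in>f ` \<Omega>. \<exists>D. \<forall>u. ((\<lambda>s. F (w + s *\<^sub>R u)) has_vector_derivative u * D) (at 0)"
      by blast
    then show ?thesis using that by (metis bchoice)
  qed
  ultimately have "F holomorphic_on f ` \<Omega>"
    using D[THEN spec[of _ 1]] D[THEN spec[of _ \<i>]]
    by (intro Looman_Menchoff[OF \<open>open (f ` \<Omega>)\<close>, of F D]) (simp_all add: scaleR_conv_of_real mult.commute)
  then show ?thesis using F by (rule that)
qed

section \<open>Cauchy's formula for a single coordinate\<close>

lemma rectifiable_linear_image:
  fixes f :: "'a::euclidean_space \<Rightarrow> 'b::real_normed_vector"
  assumes "linear f" "rectifiable \<gamma>"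
  shows "rectifiable (f \<circ> \<gamma>)"
proof -
  obtain B where B: "\<And>d. d division_of {0..1} \<Longrightarrow> (\<Sum>K\<in>d. norm (\<gamma> (Sup K) - \<gamma> (Inf K))) \<le> B"
    using assms(2) by (auto simp: rectifiable_def)
  obtain M where M: "M > 0" "\<And>x. norm (f x) \<le> M * norm x"
    using linear_bounded_pos[OF assms(1)] by blast
  have "(\<Sum>K\<in>d. norm ((f \<circ> \<gamma>) (Sup K) - (f \<circ> \<gamma>) (Inf K))) \<le> M * B" if d: "d division_of {0..1}" for d
  proof -
    have "(\<Sum>K\<in>d. norm ((f \<circ> \<gamma>) (Sup K) - (f \<circ> \<gamma>) (Inf K))) \<le> (\<Sum>K\<in>d. M * norm (\<gamma> (Sup K) - \<gamma> (Inf K)))"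
      using M(2) by (intro sum_mono) (simp add: linear_diff[OF assms(1), symmetric])
    also have "\<dots> \<le> M * B"
      unfolding sum_distrib_left[symmetric] using M(1) B[OF d] by (intro mult_left_mono) auto
    finally show ?thesis .
  qed
  then show ?thesis unfolding rectifiable_def by blast
qed

lemma linear_image_circle:
  fixes f :: "real^3 \<Rightarrow> complex"
  assumes "linear f" "is_circle p r c"
  shows "valid_path (f \<circ> c)" "path_image c \<subseteq> cball p r"
proof -
  obtain u v where uv: "r > 0" "norm u = 1" "norm v = 1" "u \<bullet> v = 0"
    and c: "c = (\<lambda>t. p + (r * cos (2 * pi * t)) *\<^sub>R u + (r * sin (2 * pi * t)) *\<^sub>R v)"
    using assms(2) by (auto simp: is_circle_def)
  have "(f \<circ> c) = (\<lambda>t. f p + (r * cos (2 * pi * t)) *\<^sub>R f u + (r * sin (2 * pi * t)) *\<^sub>R f v)"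
    by (simp add: c fun_eq_iff linear_add[OF assms(1)] linear_scale[OF assms(1)])
  moreover have "((\<lambda>t. f p + (r * cos (2 * pi * t)) *\<^sub>R f u + (r * sin (2 * pi * t)) *\<^sub>R f v) has_vector_derivative
      (- (r * (2 * pi) * sin (2 * pi * t))) *\<^sub>R f u + (r * (2 * pi) * cos (2 * pi * t)) *\<^sub>R f v) (at t)" for t
    by (auto intro!: derivative_eq_intros simp: mult_ac)
  ultimately have "(f \<circ> c) C1_differentiable_on {0..1}"
    unfolding C1_differentiable_on_def
    by (intro exI[of _ "\<lambda>t. (- (r * (2 * pi) * sin (2 * pi * t))) *\<^sub>R f u + (r * (2 * pi) * cos (2 * pi * t)) *\<^sub>R f v"])
       (auto intro!: continuous_intros)
  then show "valid_path (f \<circ> c)"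
    unfolding valid_path_def by (rule C1_differentiable_imp_piecewise)
  have "dist p (c t) \<le> r" for t
  proof -
    have "(norm ((r * cos (2 * pi * t)) *\<^sub>R u + (r * sin (2 * pi * t)) *\<^sub>R v))\<^sup>2 = (r * cos (2 * pi * t))\<^sup>2 + (r * sin (2 * pi * t))\<^sup>2"
      using uv by (subst norm_add_Pythagorean) (auto simp: orthogonal_def power_mult_distrib)
    also have "\<dots> = r\<^sup>2 * ((cos (2 * pi * t))\<^sup>2 + (sin (2 * pi * t))\<^sup>2)"
      by (simp only: power_mult_distrib distrib_left)
    also have "\<dots> = r\<^sup>2" by simp
    finally have "(norm (c t - p))\<^sup>2 = r\<^sup>2" by (simp add: c algebra_simps)
    then have "norm (c t - p) = r" using uv(1) by (simp add: power2_eq_iff_nonneg)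
    then show ?thesis by (simp add: dist_norm norm_minus_commute)
  qed
  then show "path_image c \<subseteq> cball p r" by (auto simp: path_image_def)
qed

text \<open>The coordinate of \<open>zeta i2 i3 p\<close> at \<open>e1\<close> (with \<open>a = a1\<close>, \<open>b = b1\<close>) or at \<open>e2\<close> (with \<open>a = a2\<close>,
\<open>b = b2\<close>), see \<open>coord_zeta\<close>.\<close>

definition lin3 :: "complex \<Rightarrow> complex \<Rightarrow> real^3 \<Rightarrow> complex" where
  "lin3 a b p = of_real (p$1) + of_real (p$2) * a + of_real (p$3) * b"

lemma linear_lin3: "linear (lin3 a b)"
  by (intro linearI) (simp_all add: lin3_def algebra_simps scaleR_conv_of_real[where 'a = complex])

lemma lin3_eq_0_iff: "lin3 a b p = 0 \<longleftrightarrow> p \<in> kernel_line a b"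
  by (simp add: lin3_def kernel_line_def complex_eq_iff)

lemma left_sum_lin3:
  "left_sum f (lin3 a b \<circ> \<gamma>) n = left_sum f (\<lambda>t. of_real (\<gamma> t $ 1)) n
     + a * left_sum f (\<lambda>t. of_real (\<gamma> t $ 2)) n + b * left_sum f (\<lambda>t. of_real (\<gamma> t $ 3)) n"
  by (simp add: left_sum_def lin3_def sum_distrib_left sum.distrib[symmetric] algebra_simps)

text \<open>The three line integrals of \<open>\<psi>\<close> combine to the Stieltjes integral of \<open>F / (w - f p)\<close> along the plane
curve \<open>f \<circ> \<gamma>\<close>, where \<open>f = lin3 a b\<close> and \<open>U = F \<circ> f\<close>. The homotopy from \<open>\<gamma>\<close> to the circle is mapped by
\<open>f\<close> to one that avoids \<open>f p\<close>, and on the image of the circle Cauchy's formula for the convex set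
\<open>f ` cball p r\<close> applies.\<close>

lemma Cauchy_formula_component:
  assumes "open \<Omega>" and surj: "surj (lin3 a b)" and conv: "convex_in_direction (kernel_line a b) \<Omega>"
    and cont: "continuous_on \<Omega> U"
    and der: "\<And>p. p \<in> \<Omega> \<Longrightarrow> \<exists>d. \<forall>h.
       ((\<lambda>\<epsilon>::real. (U (p + \<epsilon> *\<^sub>R h) - U p) /\<^sub>R \<epsilon>) \<longlongrightarrow> lin3 a b h * d) (at_right 0)"
    and \<gamma>: "path \<gamma>" "rectifiable \<gamma>"
    and circle: "is_circle p r c" "cball p r \<subseteq> \<Omega>"
    and wind: "winding_number (lin3 a b \<circ> c) (lin3 a b p) = 1"
    and hom: "homotopic_loops {x \<in> \<Omega>. lin3 a b x \<noteq> lin3 a b p} \<gamma> c"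
    and \<psi>: "\<And>x. x \<in> path_image \<gamma> \<Longrightarrow> \<psi> x = U x / (lin3 a b x - lin3 a b p)"
  shows "line_integral 1 \<gamma> \<psi> + a * line_integral 2 \<gamma> \<psi> + b * line_integral 3 \<gamma> \<psi> = 2 * pi * \<i> * U p"
proof -
  define f where "f = lin3 a b"
  have lin: "linear f" by (simp add: f_def linear_lin3)
  have contf: "continuous_on A f" for A
    using lin by (simp add: linear_continuous_on linear_conv_bounded_linear)
  have segs: "closed_segment x y \<subseteq> \<Omega>" if "x \<in> \<Omega>" "y \<in> \<Omega>" "f x = f y" for x y
  proof -
    have "y - x \<in> kernel_line a b"
      using that(3) by (simp add: lin3_eq_0_iff[symmetric] f_def linear_diff[OF linear_lin3])
    then show ?thesis using conv that by (auto simp: convex_in_direction_def)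
  qed
  obtain F where F: "F holomorphic_on f ` \<Omega>" "\<And>x. x \<in> \<Omega> \<Longrightarrow> F (f x) = U x"
    using factors_through_linear_map[OF lin surj[folded f_def] \<open>open \<Omega>\<close> segs cont der[folded f_def]] by blast
  have "open (f ` \<Omega>)" "open (f ` ball p r)"
    using \<open>open \<Omega>\<close> lin surj[folded f_def] by (auto intro: open_surjective_linear_image)
  define G where "G = f ` \<Omega> - {f p}"
  define q where "q w = F w / (w - f p)" for w
  have "open G" using \<open>open (f ` \<Omega>)\<close> by (simp add: G_def open_delete)
  have q: "q holomorphic_on G"
    unfolding q_def by (intro holomorphic_intros holomorphic_on_subset[OF F(1)]) (auto simp: G_def)
  have imgs: "path_image \<gamma> \<subseteq> {x \<in> \<Omega>. f x \<noteq> f p}" "path_image c \<subseteq> {x \<in> \<Omega>. f x \<noteq> f p}"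
    using homotopic_loops_imp_subset[OF hom] by (auto simp: f_def)
  have homG: "homotopic_loops G (f \<circ> \<gamma>) (f \<circ> c)"
    using hom unfolding f_def[symmetric]
    by (rule homotopic_loops_continuous_image[OF _ contf]) (auto simp: G_def)
  have valid: "valid_path (f \<circ> c)" and cball: "path_image c \<subseteq> cball p r"
    using linear_image_circle[OF lin circle(1)] by auto
  have "r > 0" using circle(1) by (simp add: is_circle_def)
  have "(q has_contour_integral (2 * pi * \<i> * winding_number (f \<circ> c) (f p) * F (f p))) (f \<circ> c)"
    unfolding q_def
  proof (rule Cauchy_integral_formula_convex_simple)
    show "convex (f ` cball p r)" using lin by (intro convex_linear_image convex_cball)
    show "F holomorphic_on f ` cball p r" 
      using circle(2) by (intro holomorphic_on_subset[OF F(1)] image_mono)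
    have "f ` ball p r \<subseteq> interior (f ` cball p r)"
      using \<open>open (f ` ball p r)\<close> by (intro interior_maximal) auto
    then show "f p \<in> interior (f ` cball p r)" using \<open>r > 0\<close> by auto
    show "path_image (f \<circ> c) \<subseteq> f ` cball p r - {f p}"
    proof
      fix w assume "w \<in> path_image (f \<circ> c)"
      then obtain x where x: "x \<in> path_image c" "w = f x" by (auto simp: path_image_compose)
      then show "w \<in> f ` cball p r - {f p}"
        using subsetD[OF cball x(1)] subsetD[OF imgs(2) x(1)] by simp
    qed
    show "pathfinish (f \<circ> c) = pathstart (f \<circ> c)"
      using homotopic_loops_imp_loop[OF homG] by simp
  qed fact
  moreover have "p \<in> \<Omega>" using subsetD[OF circle(2), of p] \<open>r > 0\<close> by simp
  ultimately have "contour_integral (f \<circ> c) q = 2 * pi * \<i> * U p"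
    using wind F(2)[of p] by (simp add: f_def contour_integral_unique)
  moreover have "left_sum (\<lambda>t. q ((f \<circ> \<gamma>) t)) (f \<circ> \<gamma>) \<longlonglongrightarrow> contour_integral (f \<circ> c) q"
    using \<gamma> lin by (intro left_sums_tendsto_contour_integral[OF _ _ \<open>open G\<close> q homG valid]
        rectifiable_linear_image path_continuous_image contf)
  moreover have "left_sum (\<lambda>t. q ((f \<circ> \<gamma>) t)) (f \<circ> \<gamma>) \<longlonglongrightarrow>
      line_integral 1 \<gamma> \<psi> + a * line_integral 2 \<gamma> \<psi> + b * line_integral 3 \<gamma> \<psi>"
  proof -
    have "continuous_on (path_image \<gamma>) (\<lambda>x. U x / (f x - f p))"
      using imgs(1) by (intro continuous_intros contf continuous_on_subset[OF cont]) auto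
    then have cont\<psi>: "continuous_on (path_image \<gamma>) \<psi>"
      using \<psi> by (simp add: f_def cong: continuous_on_cong)
    have "q (f (\<gamma> t)) = \<psi> (\<gamma> t)" if "t \<in> {0..1}" for t
    proof -
      have "\<gamma> t \<in> path_image \<gamma>" using that by (auto simp: path_image_def)
      then show ?thesis using \<psi> F(2) imgs(1) by (auto simp: q_def f_def)
    qed
    then have "left_sum (\<lambda>t. q ((f \<circ> \<gamma>) t)) (f \<circ> \<gamma>) n = left_sum (\<lambda>t. \<psi> (\<gamma> t)) (lin3 a b \<circ> \<gamma>) n" for n
      unfolding left_sum_def f_def[symmetric] by (intro sum.cong refl) simp
    then have "left_sum (\<lambda>t. q ((f \<circ> \<gamma>) t)) (f \<circ> \<gamma>) = (\<lambda>n. left_sum (\<lambda>t. \<psi> (\<gamma> t)) (\<lambda>t. of_real (\<gamma> t $ 1)) n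
       + a * left_sum (\<lambda>t. \<psi> (\<gamma> t)) (\<lambda>t. of_real (\<gamma> t $ 2)) n + b * left_sum (\<lambda>t. \<psi> (\<gamma> t)) (\<lambda>t. of_real (\<gamma> t $ 3)) n)"
      unfolding left_sum_lin3 by blast
    then show ?thesis
      by (auto intro!: tendsto_intros line_integral_limit \<gamma> cont\<psi>)
  qed
  ultimately show ?thesis using LIMSEQ_unique by metis
qed

section \<open>Coordinates of complex quaternions\<close>

lemma coord_linear:
  "coord1 (p + q) = coord1 p + coord1 q" "coord2 (p + q) = coord2 p + coord2 q"
  "coord3 (p + q) = coord3 p + coord3 q" "coord4 (p + q) = coord4 p + coord4 q"
  "coord1 (p - q) = coord1 p - coord1 q" "coord2 (p - q) = coord2 p - coord2 q"
  "coord3 (p - q) = coord3 p - coord3 q" "coord4 (p - q) = coord4 p - coord4 q"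
  "coord1 (r *\<^sub>R q) = r *\<^sub>R coord1 q" "coord2 (r *\<^sub>R q) = r *\<^sub>R coord2 q"
  "coord3 (r *\<^sub>R q) = r *\<^sub>R coord3 q" "coord4 (r *\<^sub>R q) = r *\<^sub>R coord4 q"
  by (simp_all add: coord_defs cquat_defs scaleR_cquat_def algebra_simps)

text \<open>For a factor in \<open>E3\<close>, whose third and fourth coordinates vanish, these rules are the diagonal actions
through which the Cauchy formulas split into scalar ones.\<close>

lemma coord_mult:
  "coord1 (p * q) = coord1 p * coord1 q + coord3 p * coord4 q"
  "coord2 (p * q) = coord2 p * coord2 q + coord4 p * coord3 q"
  "coord3 (p * q) = coord1 p * coord3 q + coord3 p * coord2 q"
  "coord4 (p * q) = coord2 p * coord4 q + coord4 p * coord1 q"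
  by (simp_all add: coord_defs cquat_defs algebra_simps)

lemma coord_basis:
  "coord1 e1 = 1" "coord2 e1 = 0" "coord3 e1 = 0" "coord4 e1 = 0"
  "coord1 e2 = 0" "coord2 e2 = 1" "coord3 e2 = 0" "coord4 e2 = 0"
  "coord1 e3 = 0" "coord2 e3 = 0" "coord3 e3 = 1" "coord4 e3 = 0"
  "coord1 e4 = 0" "coord2 e4 = 0" "coord3 e4 = 0" "coord4 e4 = 1"
  "coord1 1 = 1" "coord2 1 = 1" "coord3 1 = 0" "coord4 1 = 0"
  "coord1 (of_complex w) = w" "coord2 (of_complex w) = w" "coord3 (of_complex w) = 0" "coord4 (of_complex w) = 0"
  "coord1 0 = 0" "coord2 0 = 0" "coord3 0 = 0" "coord4 0 = 0"
  by (simp_all add: coord_defs e_defs cquat_defs field_simps)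

lemma cquat_eq_coord_iff:
  "p = q \<longleftrightarrow> coord1 p = coord1 q \<and> coord2 p = coord2 q \<and> coord3 p = coord3 q \<and> coord4 p = coord4 q"
  by (metis coord_unique)

lemma bounded_linear_coord:
  "bounded_linear coord1" "bounded_linear coord2" "bounded_linear coord3" "bounded_linear coord4"
proof -
  have le: "norm (q1 q) \<le> norm q" "norm (qI q) \<le> norm q" "norm (qJ q) \<le> norm q" "norm (qK q) \<le> norm q" for q
    unfolding norm_cquat_def
    by (rule norm_fst_le order_trans[OF norm_fst_le norm_snd_le]
        order_trans[OF order_trans[OF norm_fst_le norm_snd_le] norm_snd_le]
        order_trans[OF order_trans[OF norm_snd_le norm_snd_le] norm_snd_le])+
  have "norm (coord1 q) \<le> norm q * 2" "norm (coord2 q) \<le> norm q * 2"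
    "norm (coord3 q) \<le> norm q * 2" "norm (coord4 q) \<le> norm q * 2" for q
    using le[of q] norm_triangle_ineq4[of "q1 q" "\<i> * qI q"] norm_triangle_ineq[of "q1 q" "\<i> * qI q"]
      norm_triangle_ineq4[of "- \<i> * qJ q" "qK q"] norm_triangle_ineq[of "- \<i> * qJ q" "qK q"]
    by (simp_all add: coord_defs norm_mult)
  then show "bounded_linear coord1" "bounded_linear coord2" "bounded_linear coord3" "bounded_linear coord4"
    by (auto intro!: bounded_linear_intro simp: coord_linear)
qed

lemma coord_qinv_diagonal:
  assumes "coord3 q = 0" "coord4 q = 0" "coord1 q \<noteq> 0" "coord2 q \<noteq> 0"
  shows "coord1 (qinv q) = inverse (coord1 q)" "coord2 (qinv q) = inverse (coord2 q)"
    "coord3 (qinv q) = 0" "coord4 (qinv q) = 0"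
proof -
  define p where "p = of_complex (inverse (coord1 q)) * e1 + of_complex (inverse (coord2 q)) * e2"
  have "qinv q = p"
    by (rule qinv_eqI) (use assms in \<open>simp_all add: p_def cquat_eq_coord_iff coord_linear coord_mult coord_basis\<close>)
  then show "coord1 (qinv q) = inverse (coord1 q)" "coord2 (qinv q) = inverse (coord2 q)"
    "coord3 (qinv q) = 0" "coord4 (qinv q) = 0"
    by (simp_all add: p_def coord_linear coord_mult coord_basis)
qed

lemma coord_zeta:
  assumes "i2 = of_complex a1 * e1 + of_complex a2 * e2" "i3 = of_complex b1 * e1 + of_complex b2 * e2"
  shows "coord1 (zeta i2 i3 p) = lin3 a1 b1 p" "coord2 (zeta i2 i3 p) = lin3 a2 b2 p"
    "coord3 (zeta i2 i3 p) = 0" "coord4 (zeta i2 i3 p) = 0"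
  by (simp_all add: zeta_def assms lin3_def coord_linear coord_mult coord_basis
      scaleR_conv_of_real[where 'a = complex])

lemma linear_zeta: "linear (zeta i2 i3)"
  by (intro linearI) (simp_all add: zeta_def algebra_simps)

lemma coord_integral_dzeta_left:
  fixes \<gamma> :: "real \<Rightarrow> real^3" and \<Psi> :: "cquat \<Rightarrow> cquat"
  assumes "i2 = of_complex a1 * e1 + of_complex a2 * e2" "i3 = of_complex b1 * e1 + of_complex b2 * e2"
  defines "LI \<equiv> \<lambda>\<psi> j. line_integral j \<gamma> (\<lambda>p. \<psi> (\<Psi> (zeta i2 i3 p)))"
  shows "coord1 (integral_dzeta_left i2 i3 \<gamma> \<Psi>) = LI coord1 1 + a1 * LI coord1 2 + b1 * LI coord1 3"
    "coord2 (integral_dzeta_left i2 i3 \<gamma> \<Psi>) = LI coord2 1 + a2 * LI coord2 2 + b2 * LI coord2 3"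
    "coord3 (integral_dzeta_left i2 i3 \<gamma> \<Psi>) = LI coord3 1 + a1 * LI coord3 2 + b1 * LI coord3 3"
    "coord4 (integral_dzeta_left i2 i3 \<gamma> \<Psi>) = LI coord4 1 + a2 * LI coord4 2 + b2 * LI coord4 3"
  unfolding integral_dzeta_left_def LI_def
  by (simp_all add: coord_linear coord_mult coord_basis) (simp_all add: assms coord_linear coord_mult coord_basis)

lemma coord_integral_dzeta_right:
  fixes \<gamma> :: "real \<Rightarrow> real^3" and \<Psi> :: "cquat \<Rightarrow> cquat"
  assumes "i2 = of_complex a1 * e1 + of_complex a2 * e2" "i3 = of_complex b1 * e1 + of_complex b2 * e2"
  defines "LI \<equiv> \<lambda>\<psi> j. line_integral j \<gamma> (\<lambda>p. \<psi> (\<Psi> (zeta i2 i3 p)))"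
  shows "coord1 (integral_dzeta_right i2 i3 \<gamma> \<Psi>) = LI coord1 1 + a1 * LI coord1 2 + b1 * LI coord1 3"
    "coord2 (integral_dzeta_right i2 i3 \<gamma> \<Psi>) = LI coord2 1 + a2 * LI coord2 2 + b2 * LI coord2 3"
    "coord3 (integral_dzeta_right i2 i3 \<gamma> \<Psi>) = LI coord3 1 + a2 * LI coord3 2 + b2 * LI coord3 3"
    "coord4 (integral_dzeta_right i2 i3 \<gamma> \<Psi>) = LI coord4 1 + a1 * LI coord4 2 + b1 * LI coord4 3"
  unfolding integral_dzeta_right_def LI_def
  by (simp_all add: coord_linear coord_mult coord_basis) (simp_all add: assms coord_linear coord_mult coord_basis)

text \<open>The product \<open>P\<close> stands for multiplication of \<open>h\<close> and the derivative in either order, so that the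
lemma serves both kinds of monogeneity.\<close>

lemma monogenic_component:
  assumes "continuous_on (zeta i2 i3 ` \<Omega>) \<Phi>" and coord: "bounded_linear coord"
    and der: "\<forall>\<zeta>\<in>zeta i2 i3 ` \<Omega>. \<exists>\<Phi>'. \<forall>h\<in>E3 i2 i3.
      ((\<lambda>\<epsilon>::real. (\<Phi> (\<zeta> + \<epsilon> *\<^sub>R h) - \<Phi> \<zeta>) /\<^sub>R \<epsilon>) \<longlongrightarrow> P h \<Phi>') (at_right 0)"
    and mult: "\<And>h d. coord (P (zeta i2 i3 h) d) = l h * coord d"
  shows "continuous_on \<Omega> (\<lambda>p. coord (\<Phi> (zeta i2 i3 p)))"
    and "\<And>p. p \<in> \<Omega> \<Longrightarrow> \<exists>d. \<forall>h. ((\<lambda>\<epsilon>::real. (coord (\<Phi> (zeta i2 i3 (p + \<epsilon> *\<^sub>R h))) - coord (\<Phi> (zeta i2 i3 p))) /\<^sub>R \<epsilon>)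
      \<longlongrightarrow> l h * d) (at_right 0)"
proof -
  have "continuous_on \<Omega> (zeta i2 i3)"
    using linear_zeta by (simp add: linear_continuous_on linear_conv_bounded_linear)
  then show "continuous_on \<Omega> (\<lambda>p. coord (\<Phi> (zeta i2 i3 p)))"
    by (intro bounded_linear.continuous_on[OF coord] continuous_on_compose2[OF assms(1)]) auto
next
  fix p assume "p \<in> \<Omega>"
  then obtain d where d: "\<forall>h\<in>E3 i2 i3.
      ((\<lambda>\<epsilon>::real. (\<Phi> (zeta i2 i3 p + \<epsilon> *\<^sub>R h) - \<Phi> (zeta i2 i3 p)) /\<^sub>R \<epsilon>) \<longlongrightarrow> P h d) (at_right 0)"
    using der by blast
  interpret coord: bounded_linear coord by (rule coord)
  have "((\<lambda>\<epsilon>::real. (coord (\<Phi> (zeta i2 i3 (p + \<epsilon> *\<^sub>R h))) - coord (\<Phi> (zeta i2 i3 p))) /\<^sub>R \<epsilon>)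
      \<longlongrightarrow> l h * coord d) (at_right 0)" for h
  proof -
    have "((\<lambda>\<epsilon>::real. coord ((\<Phi> (zeta i2 i3 p + \<epsilon> *\<^sub>R zeta i2 i3 h) - \<Phi> (zeta i2 i3 p)) /\<^sub>R \<epsilon>))
       \<longlongrightarrow> coord (P (zeta i2 i3 h) d)) (at_right 0)"
      using d by (intro coord.tendsto) (auto simp: E3_def)
    then show ?thesis
      by (simp add: coord.diff coord.scaleR mult linear_add[OF linear_zeta] linear_scale[OF linear_zeta])
  qed
  then show "\<exists>d. \<forall>h. ((\<lambda>\<epsilon>::real. (coord (\<Phi> (zeta i2 i3 (p + \<epsilon> *\<^sub>R h))) - coord (\<Phi> (zeta i2 i3 p))) /\<^sub>R \<epsilon>)
      \<longlongrightarrow> l h * d) (at_right 0)" by blast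
qed

section \<open>Cauchy's formula for monogenic mappings\<close>

theorem theorem3:
  fixes a1 a2 b1 b2 :: complex and i2 i3 :: cquat
    and \<Omega> :: "(real^3) set" and \<Phi> \<Phi>h :: "cquat \<Rightarrow> cquat"
    and \<zeta>0 :: cquat and \<gamma> :: "real \<Rightarrow> real^3"
  assumes i2: "i2 = of_complex a1 * e1 + of_complex a2 * e2"
    and i3: "i3 = of_complex b1 * e1 + of_complex b2 * e2"
    and lin_indep: "distinct [1, i2, i3]" "independent {1, i2, i3}"
    and f_onto: "f1 ` E3 i2 i3 = UNIV" "f2 ` E3 i2 i3 = UNIV"
    and domain: "open \<Omega>" "connected \<Omega>"
    and conv: "convex_in_direction (kernel_line a1 b1) \<Omega>"
              "convex_in_direction (kernel_line a2 b2) \<Omega>"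
    and right: "right_G_monogenic i2 i3 (zeta i2 i3 ` \<Omega>) \<Phi>"
    and left: "left_G_monogenic i2 i3 (zeta i2 i3 ` \<Omega>) \<Phi>h"
    and pt: "\<zeta>0 \<in> zeta i2 i3 ` \<Omega>"
    and curve: "simple_path \<gamma>" "pathfinish \<gamma> = pathstart \<gamma>" "rectifiable \<gamma>"
               "path_image \<gamma> \<subseteq> \<Omega>"
    and embr: "embraces_once i2 i3 \<Omega> \<gamma> \<zeta>0"
  shows "\<Phi> \<zeta>0 = of_complex (1 / (2 * of_real pi * \<i>)) *
           integral_dzeta_left i2 i3 \<gamma> (\<lambda>\<zeta>. qinv (\<zeta> - \<zeta>0) * \<Phi> \<zeta>) \<and>
         \<Phi>h \<zeta>0 = of_complex (1 / (2 * of_real pi * \<i>)) *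
           integral_dzeta_right i2 i3 \<gamma> (\<lambda>\<zeta>. \<Phi>h \<zeta> * qinv (\<zeta> - \<zeta>0))"
proof -
  note coord_z = coord_zeta[OF i2 i3]
  have f_z: "f1 (zeta i2 i3 x) = lin3 a1 b1 x" "f2 (zeta i2 i3 x) = lin3 a2 b2 x" for x
    by (simp_all add: f1_def f2_def coord_z)
  have f_i: "f1 i2 = a1" "f1 i3 = b1" "f2 i2 = a2" "f2 i3 = b2"
    by (simp_all add: i2 i3 f_linear f_basis)
  have surj: "surj (lin3 a1 b1)" "surj (lin3 a2 b2)"
    using f_onto by (simp_all add: E3_def image_image f_z)
  obtain p r c where p: "zeta i2 i3 p = \<zeta>0" and circle: "is_circle p r c" "cball p r \<subseteq> \<Omega>"
    and wind: "\<forall>f\<in>{f1, f2}. winding_number (f \<circ> zeta i2 i3 \<circ> c) (f \<zeta>0) = 1"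
    and hom: "homotopic_loops (\<Omega> - zeta i2 i3 -` M_set i2 i3 \<zeta>0) \<gamma> c"
    using embr unfolding embraces_once_def by blast
  have \<gamma>: "path \<gamma>" "rectifiable \<gamma>" using curve by (auto intro: simple_path_imp_path)
  have wind12: "winding_number (lin3 a1 b1 \<circ> c) (lin3 a1 b1 p) = 1"
    "winding_number (lin3 a2 b2 \<circ> c) (lin3 a2 b2 p) = 1"
    using wind by (simp_all add: o_def f_z p[symmetric])
  \<comment> \<open>Avoiding \<open>M_set\<close> means exactly that the images in both planes avoid the images of \<open>p\<close>.\<close>
  have off: "lin3 a1 b1 x \<noteq> lin3 a1 b1 p" "lin3 a2 b2 x \<noteq> lin3 a2 b2 p"
    if "x \<in> \<Omega> - zeta i2 i3 -` M_set i2 i3 \<zeta>0" for x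
  proof -
    have diff: "zeta i2 i3 x - \<zeta>0 = zeta i2 i3 (x - p)"
      by (simp add: p[symmetric] linear_diff[OF linear_zeta])
    have "x - p \<notin> kernel_line a1 b1" "x - p \<notin> kernel_line a2 b2"
      using that unfolding M_set_def f_i by (auto simp: E3_def diff)
    then show "lin3 a1 b1 x \<noteq> lin3 a1 b1 p" "lin3 a2 b2 x \<noteq> lin3 a2 b2 p"
      by (simp_all add: lin3_eq_0_iff[symmetric] linear_diff[OF linear_lin3])
  qed
  have hom12: "homotopic_loops {x \<in> \<Omega>. lin3 a1 b1 x \<noteq> lin3 a1 b1 p} \<gamma> c"
    "homotopic_loops {x \<in> \<Omega>. lin3 a2 b2 x \<noteq> lin3 a2 b2 p} \<gamma> c"
    using off by (auto intro!: homotopic_loops_subset[OF hom])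
  have off\<gamma>: "x \<in> \<Omega> - zeta i2 i3 -` M_set i2 i3 \<zeta>0" if "x \<in> path_image \<gamma>" for x
    using homotopic_loops_imp_subset[OF hom] that by blast
  have inv: "coord1 (qinv (zeta i2 i3 x - \<zeta>0)) = inverse (lin3 a1 b1 x - lin3 a1 b1 p)"
    "coord2 (qinv (zeta i2 i3 x - \<zeta>0)) = inverse (lin3 a2 b2 x - lin3 a2 b2 p)"
    "coord3 (qinv (zeta i2 i3 x - \<zeta>0)) = 0" "coord4 (qinv (zeta i2 i3 x - \<zeta>0)) = 0"
    if "x \<in> path_image \<gamma>" for x
    using off[OF off\<gamma>[OF that]] coord_qinv_diagonal[of "zeta i2 i3 x - \<zeta>0"]
    by (simp_all add: p[symmetric] coord_linear coord_z)
  note formula1 = Cauchy_formula_component[OF domain(1) surj(1) conv(1) _ _ \<gamma> circle wind12(1) hom12(1)]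
  note formula2 = Cauchy_formula_component[OF domain(1) surj(2) conv(2) _ _ \<gamma> circle wind12(2) hom12(2)]
  have right': "continuous_on (zeta i2 i3 ` \<Omega>) \<Phi>" "\<forall>\<zeta>\<in>zeta i2 i3 ` \<Omega>. \<exists>\<Phi>'. \<forall>h\<in>E3 i2 i3.
      ((\<lambda>\<epsilon>::real. (\<Phi> (\<zeta> + \<epsilon> *\<^sub>R h) - \<Phi> \<zeta>) /\<^sub>R \<epsilon>) \<longlongrightarrow> h * \<Phi>') (at_right 0)"
    using right by (simp_all add: right_G_monogenic_def)
  have left': "continuous_on (zeta i2 i3 ` \<Omega>) \<Phi>h" "\<forall>\<zeta>\<in>zeta i2 i3 ` \<Omega>. \<exists>\<Phi>'. \<forall>h\<in>E3 i2 i3.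
      ((\<lambda>\<epsilon>::real. (\<Phi>h (\<zeta> + \<epsilon> *\<^sub>R h) - \<Phi>h \<zeta>) /\<^sub>R \<epsilon>) \<longlongrightarrow> \<Phi>' * h) (at_right 0)"
    using left by (simp_all add: left_G_monogenic_def)
  note compR = monogenic_component[OF right'(1) _ right'(2)]
  note compL = monogenic_component[OF left'(1) _ left'(2)]
  have mult_zeta:
    "coord1 (zeta i2 i3 h * d) = lin3 a1 b1 h * coord1 d" "coord2 (zeta i2 i3 h * d) = lin3 a2 b2 h * coord2 d"
    "coord3 (zeta i2 i3 h * d) = lin3 a1 b1 h * coord3 d" "coord4 (zeta i2 i3 h * d) = lin3 a2 b2 h * coord4 d"
    "coord1 (d * zeta i2 i3 h) = lin3 a1 b1 h * coord1 d" "coord2 (d * zeta i2 i3 h) = lin3 a2 b2 h * coord2 d"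
    "coord3 (d * zeta i2 i3 h) = lin3 a2 b2 h * coord3 d" "coord4 (d * zeta i2 i3 h) = lin3 a1 b1 h * coord4 d"
    for h d
    by (simp_all add: coord_mult coord_z)
  define \<Psi> where "\<Psi> \<zeta> = qinv (\<zeta> - \<zeta>0) * \<Phi> \<zeta>" for \<zeta>
  define \<Psi>h where "\<Psi>h \<zeta> = \<Phi>h \<zeta> * qinv (\<zeta> - \<zeta>0)" for \<zeta>
  note coord_dzeta = coord_integral_dzeta_left[OF i2 i3] coord_integral_dzeta_right[OF i2 i3]
  have "coord1 (integral_dzeta_left i2 i3 \<gamma> \<Psi>) = 2 * pi * \<i> * coord1 (\<Phi> \<zeta>0)"
    unfolding coord_dzeta p[symmetric]
    by (rule formula1[OF compR[OF bounded_linear_coord(1) mult_zeta(1)]])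
       (simp_all add: \<Psi>_def coord_mult inv field_simps)
  moreover have "coord2 (integral_dzeta_left i2 i3 \<gamma> \<Psi>) = 2 * pi * \<i> * coord2 (\<Phi> \<zeta>0)"
    unfolding coord_dzeta p[symmetric]
    by (rule formula2[OF compR[OF bounded_linear_coord(2) mult_zeta(2)]])
       (simp_all add: \<Psi>_def coord_mult inv field_simps)
  moreover have "coord3 (integral_dzeta_left i2 i3 \<gamma> \<Psi>) = 2 * pi * \<i> * coord3 (\<Phi> \<zeta>0)"
    unfolding coord_dzeta p[symmetric]
    by (rule formula1[OF compR[OF bounded_linear_coord(3) mult_zeta(3)]])
       (simp_all add: \<Psi>_def coord_mult inv field_simps)
  moreover have "coord4 (integral_dzeta_left i2 i3 \<gamma> \<Psi>) = 2 * pi * \<i> * coord4 (\<Phi> \<zeta>0)"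
    unfolding coord_dzeta p[symmetric]
    by (rule formula2[OF compR[OF bounded_linear_coord(4) mult_zeta(4)]])
       (simp_all add: \<Psi>_def coord_mult inv field_simps)
  ultimately have "\<Phi> \<zeta>0 = of_complex (1 / (2 * of_real pi * \<i>)) * integral_dzeta_left i2 i3 \<gamma> \<Psi>"
    by (simp add: cquat_eq_coord_iff coord_mult coord_basis)
  moreover have "coord1 (integral_dzeta_right i2 i3 \<gamma> \<Psi>h) = 2 * pi * \<i> * coord1 (\<Phi>h \<zeta>0)"
    unfolding coord_dzeta p[symmetric]
    by (rule formula1[OF compL[OF bounded_linear_coord(1) mult_zeta(5)]])
       (simp_all add: \<Psi>h_def coord_mult inv field_simps)
  moreover have "coord2 (integral_dzeta_right i2 i3 \<gamma> \<Psi>h) = 2 * pi * \<i> * coord2 (\<Phi>h \<zeta>0)"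
    unfolding coord_dzeta p[symmetric]
    by (rule formula2[OF compL[OF bounded_linear_coord(2) mult_zeta(6)]])
       (simp_all add: \<Psi>h_def coord_mult inv field_simps)
  moreover have "coord3 (integral_dzeta_right i2 i3 \<gamma> \<Psi>h) = 2 * pi * \<i> * coord3 (\<Phi>h \<zeta>0)"
    unfolding coord_dzeta p[symmetric]
    by (rule formula2[OF compL[OF bounded_linear_coord(3) mult_zeta(7)]])
       (simp_all add: \<Psi>h_def coord_mult inv field_simps)
  moreover have "coord4 (integral_dzeta_right i2 i3 \<gamma> \<Psi>h) = 2 * pi * \<i> * coord4 (\<Phi>h \<zeta>0)"
    unfolding coord_dzeta p[symmetric]
    by (rule formula1[OF compL[OF bounded_linear_coord(4) mult_zeta(8)]])
       (simp_all add: \<Psi>h_def coord_mult inv field_simps)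
  ultimately have "\<Phi>h \<zeta>0 = of_complex (1 / (2 * of_real pi * \<i>)) * integral_dzeta_right i2 i3 \<gamma> \<Psi>h"
    by (simp add: cquat_eq_coord_iff coord_mult coord_basis)
  with \<open>\<Phi> \<zeta>0 = _\<close> show ?thesis
    unfolding \<Psi>_def \<Psi>h_def by blast
qed

end
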